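(* Let $m\in\mathbb{N}$ (so $m\geq 1$). Let $R_m\in(0,1)$ be the positive root of the equation $$2\left(-r^m-\log (1-r^m)\right)=r^m\left(1-r^{2m}\right).$$ The equation $$\frac{-r^m-\log (1-r^m)}{2r^m}\left\{-\frac{1}{r^m}\log (1-r^m)+\frac{1}{r^m}\log(1+r^m)+\frac{2}{1+r^m}\right\}+2\left(\frac{r^2}{1-r}+r+2+\frac{2}{r}\log(1-r)\right)-\frac{1}{r^m}\log (1+r^m)=0$$ has a unique root $R_{m,1}$ in $(0,1)$, and $R_{m,1}\leq R_m$. If $f\in\mathcal{B}$ with $f(z)=\sum_{n=0}^\infty a_n z^n$ for $z\in\mathbb{D}$ and $\omega\in\mathcal{B}_m$, then $$\left|\mathcal{C}f(\omega(z))\right|+\left|\mathcal{C}f'(\omega(z))\right|\phi_1(r^m)+\sum_{k=2}^{\infty}\left|a_k\right|\phi_k(r)\leq \frac{1}{r^m}\log \frac{1}{1-r^m}$$ for all $z$ with $|z|=r\leq R_{m,1}$. The number $R_{m,1}$ is the best possible, i.e. for no number $\rho\in(R_{m,1},1)$ does this inequality hold for all $f\in\mathcal{B}$, all $\omega\in\mathcal{B}_m$ and all $z$ with $|z|=r\leq\rho$.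
   Context: $\mathbb{D}=\{z\in\mathbb{C}:|z|<1\}$, and $\mathcal{B}$ is the class of analytic functions $f$ on $\mathbb{D}$ with $|f(z)|\leq 1$ for all $z\in\mathbb{D}$. For $m\in\mathbb{N}=\{1,2,\dots\}$, $$\mathcal{B}_m=\left\{\omega\in\mathcal{B}:\ \omega(0)=\omega'(0)=\cdots=\omega^{(m-1)}(0)=0\ \text{ and }\ \omega^{(m)}(0)\neq 0\right\}.$$ For an analytic function $g(z)=\sum_{n=0}^\infty b_n z^n$ on $\mathbb{D}$, the Cesàro operator is $$\mathcal{C}g(z)=\sum_{n=0}^\infty \frac{1}{n+1}\left(\sum_{k=0}^n b_k\right) z^n=\int_0^1\frac{g(tz)}{1-tz}\,dt,\qquad z\in\mathbb{D}.$$ $\mathcal{C}f(\omega(z))$ means the function $\mathcal{C}f$ evaluated at the point $\omega(z)$, i.e. $\int_0^1\frac{f(t\omega(z))}{1-t\omega(z)}\,dt$, and $\mathcal{C}f'(\omega(z))$ means $\mathcal{C}$ applied to the derivative $f'$, evaluated at $\omega(z)$, i.e. $\int_0^1\frac{f'(t\omega(z))}{1-t\omega(z)}\,dt$. For integers $k\ge 0$ and $r\in(0,1)$, $$\phi_k(r)=\sum_{i=k}^\infty\frac{r^i}{i+1}=\frac{1}{r}\int_0^r\frac{x^k}{1-x}\,dx.$$ At $r=0$, expressions such as $\frac1{r^m}\log\frac1{1-r^m}$ and $\phi_k(r)$ are understood as their limits as $r\to0^+$. $\log$ is the natural logarithm. *)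

theory Defs
  imports "HOL-Complex_Analysis.Complex_Analysis"
begin

definition schur_class :: "(complex \<Rightarrow> complex) set" where
  "schur_class = {f. f holomorphic_on ball 0 1 \<and> (\<forall>z\<in>ball 0 1. norm (f z) \<le> 1)}"

definition schur_class_ord :: "nat \<Rightarrow> (complex \<Rightarrow> complex) set" where
  "schur_class_ord m =
     {\<omega> \<in> schur_class. (\<forall>j<m. (deriv ^^ j) \<omega> 0 = 0) \<and> (deriv ^^ m) \<omega> 0 \<noteq> 0}"

definition taylor_coeff :: "(complex \<Rightarrow> complex) \<Rightarrow> nat \<Rightarrow> complex" where
  "taylor_coeff f n = (deriv ^^ n) f 0 / fact n"

lemma taylor_coeff_sums:
  assumes "f holomorphic_on ball 0 1" "norm z < 1"
  shows "(\<lambda>n. taylor_coeff f n * z ^ n) sums f z"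
  using holomorphic_power_series[of f 0 1 z] assms by (simp add: taylor_coeff_def)

definition cesaro :: "(complex \<Rightarrow> complex) \<Rightarrow> complex \<Rightarrow> complex" where
  "cesaro g z = (\<Sum>n. 1 / of_nat (n + 1) * (\<Sum>k\<le>n. taylor_coeff g k) * z ^ n)"

lemma cesaro_integral:
  assumes g: "g holomorphic_on ball 0 1" and z: "norm z < 1"
  shows "((\<lambda>t. g (of_real t * z) / (1 - of_real t * z)) has_integral cesaro g z) {0..1}"
proof -
  define c where "c n = (\<Sum>k\<le>n. taylor_coeff g k)" for n
  have sums: "(\<lambda>n. c n * w ^ n) sums (g w / (1 - w))" if w: "norm w < 1" for w
  proof -
    obtain s where s: "norm w < s" "s < 1" using dense w by blast
    have "summable (\<lambda>n. taylor_coeff g n * of_real s ^ n)"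
      using taylor_coeff_sums[OF g, of "of_real s"] s norm_ge_zero[of w]
      by (simp add: sums_iff)
    then have a: "summable (\<lambda>n. norm (taylor_coeff g n * w ^ n))"
      by (rule powser_insidea) (use s norm_ge_zero[of w] in simp)
    have b: "summable (\<lambda>n. norm (w ^ n))"
      using w by (simp add: norm_power summable_geometric)
    have "(\<lambda>n. \<Sum>i\<le>n. taylor_coeff g i * w ^ i * w ^ (n - i)) sums
            ((\<Sum>n. taylor_coeff g n * w ^ n) * (\<Sum>n. w ^ n))"
      by (rule Cauchy_product_sums[OF a b])
    moreover have "(\<Sum>i\<le>n. taylor_coeff g i * w ^ i * w ^ (n - i)) = c n * w ^ n" for n
      unfolding c_def sum_distrib_right
      by (intro sum.cong) (auto simp: mult.assoc simp flip: power_add)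
    moreover have "(\<Sum>n. taylor_coeff g n * w ^ n) = g w"
      using taylor_coeff_sums[OF g w] by (simp add: sums_iff)
    ultimately show ?thesis using w by (simp add: suminf_geometric)
  qed
  obtain s where s: "norm z < s" "s < 1" using dense z by blast
  have "summable (\<lambda>n. c n * of_real s ^ n)"
    using sums[of "of_real s"] s norm_ge_zero[of z] by (simp add: sums_iff)
  then have M: "summable (\<lambda>n. norm (c n * z ^ n))"
    by (rule powser_insidea) (use s norm_ge_zero[of z] in simp)
  define F where "F N t = (\<Sum>n<N. c n * (of_real t * z) ^ n)" for N and t :: real
  have ul: "uniform_limit {0..1} F (\<lambda>t. g (of_real t * z) / (1 - of_real t * z)) sequentially"
  proof -
    have "uniform_limit {0..1} F (\<lambda>t. \<Sum>n. c n * (of_real t * z) ^ n) sequentially"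
      unfolding F_def
    proof (rule Weierstrass_m_test[OF _ M])
      fix n and t :: real assume "t \<in> {0..1}"
      then show "norm (c n * (of_real t * z) ^ n) \<le> norm (c n * z ^ n)"
        by (auto simp: norm_mult norm_power power_mult_distrib
            intro!: mult_left_mono mult_left_le_one_le power_le_one)
    qed
    moreover have "(\<Sum>n. c n * (of_real t * z) ^ n) = g (of_real t * z) / (1 - of_real t * z)"
      if t: "t \<in> {0..1}" for t :: real
    proof -
      have "\<bar>t\<bar> * norm z \<le> norm z" using t by (auto intro: mult_left_le_one_le)
      then have "norm (of_real t * z) < 1" using z by (simp add: norm_mult)
      then show ?thesis using sums by (simp add: sums_iff)
    qed
    ultimately show ?thesis
      using uniform_limit_cong'[of "{0..1}" F F] by (metis (no_types, lifting))
  qed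
  have monom: "((\<lambda>t. c n * (of_real t * z) ^ n) has_integral (1 / of_nat (n + 1) * c n * z ^ n)) {0..1}"
    for n
  proof -
    have "((\<lambda>t::real. t ^ n) has_integral (1 ^ Suc n / real (Suc n) - 0 ^ Suc n / real (Suc n))) {0..1}"
      by (intro fundamental_theorem_of_calculus)
        (auto intro!: derivative_eq_intros
          simp: has_real_derivative_iff_has_vector_derivative[symmetric] divide_simps
          simp del: power_Suc of_nat_Suc)
    from has_integral_mult_right[OF has_integral_linear[OF this bounded_linear_of_real], of "c n * z ^ n"] show ?thesis
      by (simp add: o_def power_mult_distrib mult_ac)
  qed
  have FI: "(F N has_integral (\<Sum>n<N. 1 / of_nat (n + 1) * c n * z ^ n)) {0..1}" for N
    unfolding F_def by (intro has_integral_sum monom) auto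
  have "continuous_on {0..1} (F N)" for N
    unfolding F_def by (intro continuous_intros)
  from uniform_limit_integral[OF ul this] obtain I J where
    I: "\<And>N. (F N has_integral I N) {0..1}" and
    J: "((\<lambda>t. g (of_real t * z) / (1 - of_real t * z)) has_integral J) {0..1}" and
    lim: "I \<longlonglongrightarrow> J"
    by auto
  have "I = (\<lambda>N. \<Sum>n<N. 1 / of_nat (n + 1) * c n * z ^ n)"
    using has_integral_unique[OF I FI] by auto
  with lim have "(\<lambda>n. 1 / of_nat (n + 1) * c n * z ^ n) sums J" by (simp add: sums_def)
  then have "cesaro g z = J" by (simp add: cesaro_def c_def sums_iff)
  with J show ?thesis by simp
qed

definition phi :: "nat \<Rightarrow> real \<Rightarrow> real" where
  "phi k r = (\<Sum>i. r ^ (k + i) / real (k + i + 1))"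

text \<open>The case \<open>x = 0\<close> is the limit of the quotient as \<open>x\<close> tends to 0 from the right.\<close>

definition log_quot :: "real \<Rightarrow> real" where
  "log_quot x = (if x = 0 then 1 else 1 / x * ln (1 / (1 - x)))"

definition cesaro_bohr_ineq ::
    "nat \<Rightarrow> (complex \<Rightarrow> complex) \<Rightarrow> (complex \<Rightarrow> complex) \<Rightarrow> complex \<Rightarrow> bool" where
  "cesaro_bohr_ineq m f \<omega> z \<longleftrightarrow>
     norm (cesaro f (\<omega> z)) + norm (cesaro (deriv f) (\<omega> z)) * phi 1 (norm z ^ m)
       + (\<Sum>k. norm (taylor_coeff f (k + 2)) * phi (k + 2) (norm z))
     \<le> log_quot (norm z ^ m)"

end

theory Submission
  imports Defs
begin

text \<open>
  Write \<open>x = r\<^sup>m\<close>, \<open>a = |f 0|\<close>, \<open>\<mu> = \<phi>\<^sub>1(x)\<close>. By Schwarz-Pick, \<open>|f(\<zeta>)| + \<mu> |f'(\<zeta>)|\<close> is at most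
  \<open>y + \<mu> (1 - y\<^sup>2) / (1 - s\<^sup>2)\<close> with \<open>s = |\<zeta>|\<close> and \<open>y = |f(\<zeta>)| \<le> (a + s) / (1 + a s)\<close>. For
  \<open>s \<le> x\<close> and \<open>\<mu> \<le> (1 - x\<^sup>2) / 2\<close>, which is what \<open>r \<le> R\<^sub>m\<close> means, this is increasing in \<open>y\<close>. After
  subtracting \<open>1\<close> and dividing by \<open>1 - a\<close>, the resulting bound is largest for \<open>a = 1\<close>. Integrating it
  against \<open>1 / (1 - s)\<close> and using \<open>|a\<^sub>k| \<le> 1 - a\<^sup>2\<close>, the left-hand side exceeds the right-hand side
  by at most \<open>1 - a\<close> times the function whose zero defines \<open>R\<^sub>m\<^sub>,\<^sub>1\<close>. That function is strictly
  increasing in \<open>r\<close>, and for \<open>f(z) = (a + z) / (1 + a z)\<close>, \<open>\<omega>(z) = z\<^sup>m\<close>, \<open>z = r\<close> the excess divided by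
  \<open>1 - a\<close> tends to its value as \<open>a\<close> tends to \<open>1\<close>.
\<close>

section \<open>Schwarz-Pick estimates\<close>

text \<open>Dividing the tail of the series by \<open>z ^ k\<close> leaves the shifted power series,
  which still converges on the disc. So the quotient is holomorphic once its value at 0 is set to
  \<open>c k\<close>.\<close>

lemma power_series_remainder:
  fixes f :: "complex \<Rightarrow> complex" and c :: "nat \<Rightarrow> complex"
  assumes "\<And>z. norm z < 1 \<Longrightarrow> (\<lambda>n. c n * z ^ n) sums f z"
  obtains K where "K holomorphic_on ball 0 1" "K 0 = c k"
    "\<And>z. norm z < 1 \<Longrightarrow> f z = (\<Sum>n<k. c n * z ^ n) + z ^ k * K z"
proof -
  define K where "K z = (if z = 0 then c k else (f z - (\<Sum>n<k. c n * z ^ n)) / z ^ k)" for z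
  have K: "(\<lambda>n. c (n + k) * z ^ n) sums K z" if z: "norm z < 1" for z
  proof (cases "z = 0")
    case True
    then show ?thesis using powser_sums_zero[of "\<lambda>n. c (n + k)"] by (simp add: K_def)
  next
    case False
    have "(\<lambda>n. c (n + k) * z ^ (n + k)) sums (f z - (\<Sum>n<k. c n * z ^ n))"
      by (rule sums_split_initial_segment[OF assms[OF z]])
    from sums_divide[OF this, of "z ^ k"] show ?thesis
      using False by (simp add: K_def power_add)
  qed
  have "K holomorphic_on ball 0 1"
    using K by (intro power_series_holomorphic[of 0 1 "\<lambda>n. c (n + k)"]) auto
  moreover have "f z = (\<Sum>n<k. c n * z ^ n) + z ^ k * K z" if "norm z < 1" for z
  proof (cases "z = 0")
    case True
    have "c 0 = f 0"
      using sums_unique2[OF powser_sums_zero[of c] assms[of 0]] by simp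
    with True show ?thesis
      by (cases k) (simp_all add: K_def sum.lessThan_Suc_shift del: sum.lessThan_Suc)
  qed (simp add: K_def)
  ultimately show ?thesis using that[of K] by (simp add: K_def)
qed

lemma taylor_coeff_unique:
  assumes "\<And>z. norm z < 1 \<Longrightarrow> (\<lambda>n. c n * z ^ n) sums f z"
  shows "taylor_coeff f n = c n"
proof -
  have "\<forall>\<^sub>F u in nhds 0. (\<lambda>n. fps_nth (Abs_fps c) n * u ^ n) sums f u"
    using eventually_nhds_in_open[of "ball 0 1" "0::complex"] assms
    by (auto elim!: eventually_mono)
  from fps_nth_fps_expansion[OF has_fps_expansionI[OF this], of n] show ?thesis
    by (simp add: taylor_coeff_def)
qed

lemma taylor_coeff_0 [simp]: "taylor_coeff f 0 = f 0"
  by (simp add: taylor_coeff_def)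

text \<open>Schwarz's lemma for a zero of order \<open>k\<close>: the maximum modulus principle on
  radius \<open>\<rho>\<close> gives \<open>1 / \<rho> ^ k\<close>, and \<open>\<rho>\<close> tends
  to 1 from below.\<close>

lemma norm_le_1_of_power_factor:
  assumes K: "K holomorphic_on ball 0 1"
    and le: "\<And>z. norm z < 1 \<Longrightarrow> norm (z ^ k * K z) \<le> 1"
    and z: "norm z < 1"
  shows "norm (K z) \<le> 1"
proof -
  have bound: "norm (K z) \<le> 1 / \<rho> ^ k" if "norm z < \<rho>" "\<rho> < 1" for \<rho>
  proof (rule maximum_modulus_frontier[of K "ball 0 \<rho>"])
    have \<rho>: "\<rho> > 0" using that norm_ge_zero[of z] by linarith
    show "K holomorphic_on interior (ball 0 \<rho>)"
      using K by (rule holomorphic_on_subset) (use that in auto)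
    show "continuous_on (closure (ball 0 \<rho>)) K"
      by (rule continuous_on_subset[OF holomorphic_on_imp_continuous_on[OF K]])
        (use \<rho> that in auto)
    fix w :: complex assume "w \<in> frontier (ball 0 \<rho>)"
    then have w: "norm w = \<rho>" using \<rho> by (simp add: frontier_ball)
    with le[of w] that have "\<rho> ^ k * norm (K w) \<le> 1" by (simp add: norm_mult norm_power)
    then show "norm (K w) \<le> 1 / \<rho> ^ k" using \<rho> by (simp add: field_simps)
  qed (use that in auto)
  have "((\<lambda>\<rho>. 1 / \<rho> ^ k) \<longlongrightarrow> 1 / 1 ^ k) (at_left (1::real))"
    by (intro tendsto_intros) auto
  moreover have "\<forall>\<^sub>F \<rho> in at_left 1. norm (K z) \<le> 1 / \<rho> ^ k"
    using eventually_at_left_real[OF z] by (rule eventually_mono) (auto intro!: bound)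
  ultimately show ?thesis
    by (intro tendsto_lowerbound[of "\<lambda>\<rho>. 1 / \<rho> ^ k"]) auto
qed

text \<open>The difference of the squares factors as \<open>(1 - |c|^2) (1 - |w|^2)\<close>. The
  form without division also covers boundary values, where the denominator can vanish.\<close>

lemma norm_diff_le_norm_one_minus_cnj_mult:
  assumes "norm c \<le> 1" "norm w \<le> 1"
  shows "norm (w - c) \<le> norm (1 - cnj c * w)"
proof -
  have "(norm (1 - cnj c * w))\<^sup>2 - (norm (w - c))\<^sup>2 = (1 - (norm c)\<^sup>2) * (1 - (norm w)\<^sup>2)"
    unfolding cmod_power2 by (simp add: algebra_simps power2_eq_square)
  also have "\<dots> \<ge> 0"
    using assms by (intro mult_nonneg_nonneg) (simp_all add: power_le_one)
  finally show ?thesis by (intro power2_le_imp_le[OF _ norm_ge_zero]) simp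
qed

text \<open>Schwarz's lemma for \<open>(f z - f 0) / (1 - cnj (f 0) * f z)\<close>, whose numerator
  is \<open>z ^ k * K z\<close>. Clearing the denominator includes constant functions of modulus
  1.\<close>

lemma schur_class_cofactor_bound:
  assumes f: "f \<in> schur_class" and K: "K holomorphic_on ball 0 1"
    and fK: "\<And>z. norm z < 1 \<Longrightarrow> f z = f 0 + z ^ k * K z"
    and z: "norm z < 1"
  shows "norm (K z) \<le> norm (1 - cnj (f 0) * f z)"
proof -
  have hol: "f holomorphic_on ball 0 1" and f1: "\<And>z. norm z < 1 \<Longrightarrow> norm (f z) \<le> 1"
    using f by (auto simp: schur_class_def)
  text \<open>Scaling by \<open>\<tau> < 1\<close> keeps the denominator away from 0 also if \<open>|f 0| = 1\<close>.\<close>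
  have bound: "norm (\<tau> * K z) \<le> norm (1 - \<tau>\<^sup>2 * cnj (f 0) * f z)" if \<tau>: "0 < \<tau>" "\<tau> < 1" for \<tau> :: real
  proof -
    have lt: "norm (complex_of_real \<tau> * f w) < 1" if "norm w < 1" for w
      using f1[OF that] \<tau> by (auto simp: norm_mult intro: order.strict_trans1[OF mult_left_le])
    have nz: "1 - \<tau>\<^sup>2 * cnj (f 0) * f w \<noteq> 0" if "norm w < 1" for w
    proof -
      have "norm ((\<tau> * cnj (f 0)) * (\<tau> * f w)) < 1"
        using lt[OF that] lt[of 0] norm_mult_less[of "\<tau> * cnj (f 0)" 1 "\<tau> * f w" 1]
        by (simp add: norm_mult)
      then show ?thesis by (auto simp: power2_eq_square mult_ac)
    qed
    have "norm (\<tau> * K z / (1 - \<tau>\<^sup>2 * cnj (f 0) * f z)) \<le> 1"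
    proof (rule norm_le_1_of_power_factor[where k = k
          and K = "\<lambda>z. \<tau> * K z / (1 - \<tau>\<^sup>2 * cnj (f 0) * f z)"])
      show "(\<lambda>z. \<tau> * K z / (1 - \<tau>\<^sup>2 * cnj (f 0) * f z)) holomorphic_on ball 0 1"
        using nz by (intro holomorphic_intros hol K) auto
      fix w :: complex assume w: "norm w < 1"
      have "\<tau> * f w - \<tau> * f 0 = w ^ k * (\<tau> * K w)"
        using fK[OF w] by (simp add: algebra_simps)
      then have "norm (w ^ k * (\<tau> * K w)) \<le> norm (1 - \<tau>\<^sup>2 * cnj (f 0) * f w)"
        using norm_diff_le_norm_one_minus_cnj_mult[of "\<tau> * f 0" "\<tau> * f w"] lt[OF w] lt[of 0]
        by (simp add: power2_eq_square mult_ac)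
      then show "norm (w ^ k * (\<tau> * K w / (1 - \<tau>\<^sup>2 * cnj (f 0) * f w))) \<le> 1"
        using nz[OF w] by (simp add: norm_mult norm_divide divide_simps)
    qed (fact z)
    then show ?thesis using nz[OF z] by (simp add: norm_divide divide_simps)
  qed
  have "((\<lambda>\<tau>. norm (complex_of_real \<tau> * K z)) \<longlongrightarrow> norm (complex_of_real 1 * K z)) (at_left 1)"
    by (intro tendsto_intros)
  moreover have "((\<lambda>\<tau>. norm (1 - complex_of_real (\<tau>\<^sup>2) * cnj (f 0) * f z))
      \<longlongrightarrow> norm (1 - complex_of_real (1\<^sup>2) * cnj (f 0) * f z)) (at_left 1)"
    by (intro tendsto_intros)
  moreover have "\<forall>\<^sub>F \<tau> in at_left 1. norm (complex_of_real \<tau> * K z)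
      \<le> norm (1 - complex_of_real (\<tau>\<^sup>2) * cnj (f 0) * f z)"
    using eventually_at_left_real[of 0 1, simplified] by (rule eventually_mono) (use bound in simp)
  ultimately show ?thesis
    using tendsto_le[of "at_left (1::real)"] by fastforce
qed

lemma schur_class_ord_bound:
  assumes "\<omega> \<in> schur_class_ord m" and "norm z < 1"
  shows "norm (\<omega> z) \<le> norm z ^ m"
proof -
  have \<omega>: "\<omega> holomorphic_on ball 0 1" "\<And>z. norm z < 1 \<Longrightarrow> norm (\<omega> z) \<le> 1"
    "\<And>j. j < m \<Longrightarrow> taylor_coeff \<omega> j = 0"
    using assms by (auto simp: schur_class_ord_def schur_class_def taylor_coeff_def)
  obtain K where K: "K holomorphic_on ball 0 1"
    "\<And>z. norm z < 1 \<Longrightarrow> \<omega> z = (\<Sum>n<m. taylor_coeff \<omega> n * z ^ n) + z ^ m * K z"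
    using power_series_remainder[OF taylor_coeff_sums[OF \<omega>(1)], of m] by blast
  have eq: "\<omega> z = z ^ m * K z" if "norm z < 1" for z
    using K(2)[OF that] \<omega>(3) by simp
  have "norm (K z) \<le> 1"
    by (rule norm_le_1_of_power_factor[OF K(1) _ assms(2), of m]) (use eq \<omega>(2) in metis)
  then show ?thesis
    using eq[OF assms(2)] by (simp add: norm_mult norm_power mult_left_le)
qed

text \<open>The cofactor bound with exponent 1 controls the pseudo-hyperbolic distance of
  \<open>f z\<close> and \<open>f 0\<close>. The estimate
  \<open>|1 - cnj (f 0) * f z| >= 1 - a * y\<close> reduces it to moduli, and the resulting
  inequality is solved for \<open>y\<close>.\<close>

lemma schur_class_norm_bound:
  assumes f: "f \<in> schur_class" and z: "norm z < 1"
  shows "norm (f z) \<le> (norm (f 0) + norm z) / (1 + norm (f 0) * norm z)"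
proof -
  have hol: "f holomorphic_on ball 0 1" and f1: "\<And>z. norm z < 1 \<Longrightarrow> norm (f z) \<le> 1"
    using f by (auto simp: schur_class_def)
  define a y s where "a = norm (f 0)" and "y = norm (f z)" and "s = norm z"
  have ays: "0 \<le> a" "a \<le> 1" "0 \<le> y" "y \<le> 1" "0 \<le> s" "s < 1"
    using f1[of 0] f1[OF z] z by (auto simp: a_def y_def s_def)
  obtain K where K: "K holomorphic_on ball 0 1"
    "\<And>z. norm z < 1 \<Longrightarrow> f z = (\<Sum>n<1. taylor_coeff f n * z ^ n) + z ^ 1 * K z"
    using power_series_remainder[OF taylor_coeff_sums[OF hol], of 1] by blast
  have fK: "f z = f 0 + z ^ 1 * K z" if "norm z < 1" for z
    using K(2)[OF that] by simp
  have "norm (f z - f 0) \<le> s * norm (1 - cnj (f 0) * f z)"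
    using schur_class_cofactor_bound[OF f K(1) fK z] fK[OF z]
    by (simp add: norm_mult s_def mult_left_mono)
  then have "(norm (f z - f 0))\<^sup>2 \<le> (s * norm (1 - cnj (f 0) * f z))\<^sup>2"
    by (intro power_mono) auto
  moreover have "(norm (1 - cnj (f 0) * f z))\<^sup>2 - (norm (f z - f 0))\<^sup>2 = (1 - a\<^sup>2) * (1 - y\<^sup>2)"
    unfolding cmod_power2 a_def y_def by (simp add: algebra_simps power2_eq_square)
  ultimately have 1: "(1 - s\<^sup>2) * (norm (1 - cnj (f 0) * f z))\<^sup>2 \<le> (1 - a\<^sup>2) * (1 - y\<^sup>2)"
    by (simp add: power_mult_distrib algebra_simps)
  have "norm (1 - cnj (f 0) * f z) \<ge> 1 - a * y"
    using norm_triangle_ineq2[of 1 "cnj (f 0) * f z"] by (simp add: norm_mult a_def y_def)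
  moreover have ay: "a * y \<le> 1" using ays by (simp add: mult_le_one)
  ultimately have "(1 - a * y)\<^sup>2 \<le> (norm (1 - cnj (f 0) * f z))\<^sup>2"
    by (intro power_mono) auto
  then have "(1 - s\<^sup>2) * (1 - a * y)\<^sup>2 \<le> (1 - s\<^sup>2) * (norm (1 - cnj (f 0) * f z))\<^sup>2"
    using ays by (intro mult_left_mono) (auto simp: power_le_one)
  \<comment> \<open>Uses \<open>(1 - a * y)\<^sup>2 - (1 - a\<^sup>2) * (1 - y\<^sup>2) = (y -
    a)\<^sup>2\<close>.\<close>
  with 1 have "(y - a)\<^sup>2 \<le> (s * (1 - a * y))\<^sup>2"
    by (simp add: power2_eq_square algebra_simps)
  then have "y - a \<le> s * (1 - a * y)"
    by (rule power2_le_imp_le) (use ay ays(5) in simp)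
  moreover have "1 + a * s > 0" using ays by (simp add: add_pos_nonneg)
  ultimately have "y \<le> (a + s) / (1 + a * s)" by (simp add: pos_le_divide_eq algebra_simps)
  then show ?thesis by (simp add: a_def y_def s_def)
qed

text \<open>Averaging \<open>f\<close> over the rotations by \<open>k\<close>-th roots of unity removes all Taylor coefficients
  strictly between \<open>0\<close> and \<open>k\<close>.\<close>

lemma schur_class_taylor_coeff_bound:
  assumes f: "f \<in> schur_class" and k: "k \<ge> 1"
  shows "norm (taylor_coeff f k) \<le> 1 - (norm (f 0))\<^sup>2"
proof -
  have hol: "f holomorphic_on ball 0 1" and f1: "\<And>z. norm z < 1 \<Longrightarrow> norm (f z) \<le> 1"
    using f by (auto simp: schur_class_def)
  define \<zeta> where "\<zeta> j = exp (2 * of_real pi * \<i> * of_nat j / of_nat k)" for j :: nat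
  have \<zeta>_norm: "norm (\<zeta> j) = 1" for j by (simp add: \<zeta>_def)
  \<comment> \<open>This symmetry turns the sum of \<open>\<zeta> j ^ n\<close> over
    \<open>j\<close> into a geometric sum with ratio \<open>\<zeta> n\<close>.\<close>
  have \<zeta>_power: "\<zeta> j ^ n = \<zeta> n ^ j" for j n
    by (simp add: \<zeta>_def mult_ac flip: exp_of_nat_mult)
  have \<zeta>_k: "\<zeta> n ^ k = 1" for n
  proof -
    have "\<zeta> n ^ k = exp (of_nat n * (2 * of_real pi * \<i>))"
      using k by (simp add: \<zeta>_def mult_ac flip: exp_of_nat_mult)
    also have "\<dots> = 1" by (subst exp_of_nat_mult) simp
    finally show ?thesis .
  qed
  have \<zeta>_sum: "(\<Sum>j<k. \<zeta> j ^ n) = (if k dvd n then of_nat k else 0)" for n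
  proof (cases "k dvd n")
    case True
    then have "\<zeta> n = 1" using complex_root_unity_eq_1[OF k, of n] by (simp add: \<zeta>_def)
    then show ?thesis using True by (simp add: \<zeta>_power[of _ n])
  next
    case False
    then have "\<zeta> n \<noteq> 1" using complex_root_unity_eq_1[OF k, of n] by (simp add: \<zeta>_def)
    then show ?thesis using False \<zeta>_k by (simp add: \<zeta>_power[of _ n] geometric_sum)
  qed
  define c where "c n = (if k dvd n then taylor_coeff f n else 0)" for n
  define g where "g z = (\<Sum>j<k. f (\<zeta> j * z)) / of_nat k" for z
  have g_sums: "(\<lambda>n. c n * z ^ n) sums g z" if z: "norm z < 1" for z
  proof -
    have "(\<lambda>n. (\<Sum>j<k. taylor_coeff f n * (\<zeta> j * z) ^ n) / of_nat k) sums g z"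
      unfolding g_def using z
      by (intro sums_divide sums_sum taylor_coeff_sums hol) (simp add: norm_mult \<zeta>_norm)
    moreover have "(\<Sum>j<k. taylor_coeff f n * (\<zeta> j * z) ^ n) / of_nat k = c n * z ^ n" for n
    proof -
      have "(\<Sum>j<k. taylor_coeff f n * (\<zeta> j * z) ^ n) = taylor_coeff f n * z ^ n * (\<Sum>j<k. \<zeta> j ^ n)"
        by (simp add: sum_distrib_left power_mult_distrib mult_ac)
      then show ?thesis using k by (simp add: \<zeta>_sum c_def)
    qed
    ultimately show ?thesis by simp
  qed
  have g: "g \<in> schur_class"
  proof -
    have "g holomorphic_on ball 0 1"
      by (rule power_series_holomorphic[of 0 1 c]) (use g_sums in auto)
    moreover have "norm (g z) \<le> 1" if "norm z < 1" for z
    proof -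
      have "norm (\<Sum>j<k. f (\<zeta> j * z)) \<le> (\<Sum>j<k. 1)"
        by (rule sum_norm_le) (use that in \<open>auto intro!: f1 simp: norm_mult \<zeta>_norm\<close>)
      then show ?thesis using k by (simp add: g_def norm_divide divide_simps)
    qed
    ultimately show ?thesis by (simp add: schur_class_def)
  qed
  have g0: "g 0 = f 0" using k by (simp add: g_def)
  obtain K where K: "K holomorphic_on ball 0 1" "K 0 = c k"
    "\<And>z. norm z < 1 \<Longrightarrow> g z = (\<Sum>n<k. c n * z ^ n) + z ^ k * K z"
    using power_series_remainder[OF g_sums, of k] by blast
  have "(\<Sum>n<k. c n * z ^ n) = f 0" for z
  proof -
    have "(\<Sum>n<k. c n * z ^ n) = (\<Sum>n\<in>{0}. c n * z ^ n)"
      using k by (intro sum.mono_neutral_right) (auto simp: c_def dest: dvd_imp_le)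
    then show ?thesis by (simp add: c_def)
  qed
  with K(3) g0 have gK: "\<And>z. norm z < 1 \<Longrightarrow> g z = g 0 + z ^ k * K z" by metis
  \<comment> \<open>At 0 the cofactor is the k-th Taylor coefficient of \<open>f\<close>, and
    \<open>g 0 = f 0\<close> turns the right-hand side into \<open>1 - |f 0|^2\<close>.\<close>
  have "norm (K 0) \<le> norm (1 - cnj (g 0) * g 0)"
    by (rule schur_class_cofactor_bound[OF g K(1) gK]) auto
  also have "cnj (g 0) * g 0 = of_real ((norm (f 0))\<^sup>2)"
    by (simp add: g0 complex_norm_square mult.commute del: of_real_power)
  also have "norm (1 - complex_of_real ((norm (f 0))\<^sup>2)) = \<bar>1 - (norm (f 0))\<^sup>2\<bar>"
    by (metis norm_of_real of_real_1 of_real_diff)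
  also have "\<dots> = 1 - (norm (f 0))\<^sup>2"
    using f1[of 0] by (simp add: power_le_one)
  finally show ?thesis by (simp add: K(2) c_def)
qed

text \<open>Precomposing with the disc automorphism that carries 0 to \<open>z\<close> reduces this
  to the bound for the first Taylor coefficient; the chain rule contributes the factor
  \<open>1 - |z|^2\<close>.\<close>

lemma schwarz_pick_deriv:
  assumes f: "f \<in> schur_class" and z: "norm z < 1"
  shows "norm (deriv f z) \<le> (1 - (norm (f z))\<^sup>2) / (1 - (norm z)\<^sup>2)"
proof -
  have hol: "f holomorphic_on ball 0 1" and f1: "\<And>z. norm z < 1 \<Longrightarrow> norm (f z) \<le> 1"
    using f by (auto simp: schur_class_def)
  \<comment> \<open>The sign makes this the map sending \<open>u\<close> to
    \<open>(u + z) / (1 + cnj z * u)\<close>.\<close>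
  define M where "M = Moebius_function 0 (- z)"
  have M1: "norm (M u) < 1" if "norm u < 1" for u
    unfolding M_def using that z by (intro Moebius_function_norm_lt_1) auto
  have M0: "M 0 = z" by (simp add: M_def Moebius_function_of_zero)
  have Mhol: "M holomorphic_on ball 0 1"
    unfolding M_def using z by (intro Moebius_function_holomorphic) auto
  have "(M has_field_derivative (1 - z * cnj z)) (at 0)"
    unfolding M_def Moebius_function_def
    by (auto intro!: derivative_eq_intros simp: algebra_simps)
  moreover have "(f has_field_derivative deriv f (M 0)) (at (M 0))"
    using z by (intro holomorphic_derivI[OF hol]) (auto simp: M0)
  ultimately have "((f \<circ> M) has_field_derivative deriv f z * (1 - z * cnj z)) (at 0)"
    using DERIV_chain[of f "deriv f (M 0)" M 0] by (simp add: M0)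
  then have "taylor_coeff (f \<circ> M) 1 = deriv f z * (1 - z * cnj z)"
    by (simp add: taylor_coeff_def DERIV_imp_deriv)
  also have "\<dots> = deriv f z * of_real (1 - (norm z)\<^sup>2)"
    by (simp add: complex_norm_square del: of_real_power)
  finally have "norm (taylor_coeff (f \<circ> M) 1) = norm (deriv f z) * (1 - (norm z)\<^sup>2)"
    using z by (simp only: norm_mult norm_of_real) (simp add: power_le_one)
  moreover have "f \<circ> M \<in> schur_class"
    using M1 f1 holomorphic_on_compose_gen[OF Mhol hol]
    by (auto simp: schur_class_def image_subset_iff)
  from schur_class_taylor_coeff_bound[OF this, of 1]
  have "norm (taylor_coeff (f \<circ> M) 1) \<le> 1 - (norm (f z))\<^sup>2" by (simp add: M0)
  moreover have "1 - (norm z)\<^sup>2 > 0" using z by (simp add: power_less_one_iff abs_square_less_1)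
  ultimately show ?thesis by (simp add: field_simps)
qed

section \<open>The functions in the defining equations\<close>

lemma phi_term_le:
  fixes r :: real
  assumes "0 \<le> r"
  shows "r ^ (k + i) / real (k + i + 1) \<le> r ^ k * r ^ i"
  using mult_left_mono[of 1 "real (k + i + 1)" "r ^ (k + i)"] assms
  by (simp add: power_add field_simps)

lemma summable_phi:
  assumes "0 \<le> r" "r < 1"
  shows "summable (\<lambda>i. r ^ (k + i) / real (k + i + 1))"
proof (rule summable_comparison_test)
  show "\<exists>N. \<forall>n\<ge>N. norm (r ^ (k + n) / real (k + n + 1)) \<le> r ^ k * r ^ n"
    using phi_term_le[OF assms(1), of k] assms by auto
  show "summable (\<lambda>n. r ^ k * r ^ n)"
    using assms by (intro summable_mult summable_geometric) auto
qed

lemma phi_nonneg: "0 \<le> r \<Longrightarrow> r < 1 \<Longrightarrow> 0 \<le> phi k r"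
  unfolding phi_def by (intro suminf_nonneg summable_phi) auto

lemma phi_le:
  assumes "0 \<le> r" "r < 1"
  shows "phi k r \<le> r ^ k / (1 - r)"
proof -
  have "phi k r \<le> (\<Sum>i. r ^ k * r ^ i)"
    unfolding phi_def using assms
    by (intro suminf_le phi_term_le summable_phi summable_mult summable_geometric) auto
  also have "\<dots> = r ^ k / (1 - r)"
    using assms by (subst suminf_mult) (auto simp: suminf_geometric summable_geometric)
  finally show ?thesis .
qed

lemma phi_Suc:
  assumes "0 \<le> r" "r < 1"
  shows "phi k r = r ^ k / real (k + 1) + phi (Suc k) r"
  using suminf_split_head[OF summable_phi[OF assms, of k]] by (simp add: phi_def)

lemma phi_0_eq:
  assumes "0 < r" "r < 1"
  shows "phi 0 r = - ln (1 - r) / r"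
proof -
  have "(\<lambda>n. - ((- (- r)) ^ n) / of_nat n) sums ln (1 + (- r))"
    by (rule ln_series') (use assms in auto)
  then have "(\<lambda>n. - (r ^ Suc n) / real (Suc n)) sums ln (1 - r)"
    by (subst sums_Suc_iff) simp
  from sums_divide[OF sums_minus[OF this], of r]
  moreover have "- (- (r ^ Suc n) / real (Suc n)) / r = r ^ n / real (n + 1)" for n
    using assms by (simp add: divide_simps)
  ultimately have "(\<lambda>n. r ^ n / real (n + 1)) sums (- ln (1 - r) / r)"
    by simp
  then show ?thesis by (simp add: phi_def sums_iff)
qed

lemma phi_1_eq:
  assumes "0 < r" "r < 1"
  shows "phi 1 r = (- r - ln (1 - r)) / r"
  using phi_Suc[of r 0] phi_0_eq[OF assms] assms by (simp add: field_simps)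

text \<open>Summation by parts, resting on
  \<open>(n + 1) * phi n r = r ^ n + (n + 1) * phi (n + 1) r\<close>.\<close>

lemma sum_phi:
  assumes "0 \<le> r" "r < 1"
  shows "(\<Sum>k<n. phi k r) = real n * phi n r + (\<Sum>k<n. r ^ k)"
proof (induction n)
  case (Suc n)
  have "real (n + 1) * phi n r = r ^ n + real (n + 1) * phi (Suc n) r"
    using phi_Suc[OF assms, of n] by (simp add: field_simps)
  with Suc show ?case by (simp add: algebra_simps)
qed simp

text \<open>Closed form of the sum of \<open>phi k r\<close> over \<open>k >= 2\<close>. Twice this
  is the middle term of the equation for \<open>R\<^sub>m\<^sub>,\<^sub>1\<close>, because
  \<open>r^2 / (1 - r) + r = r / (1 - r)\<close>.\<close>

definition phi_tail :: "real \<Rightarrow> real" where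
  "phi_tail r = r / (1 - r) + 2 + 2 / r * ln (1 - r)"

text \<open>Since \<open>n * phi n r\<close> tends to 0, the sum of all \<open>phi k r\<close>
  equals the geometric series; removing the terms for 0 and 1 brings in the logarithm.\<close>

lemma phi_tail_sums:
  assumes "0 < r" "r < 1"
  shows "(\<lambda>k. phi (k + 2) r) sums phi_tail r"
proof -
  have "(\<lambda>n. real n * phi n r) \<longlonglongrightarrow> 0"
  proof (rule tendsto_sandwich)
    show "\<forall>\<^sub>F n in sequentially. 0 \<le> real n * phi n r"
      using assms by (auto intro!: always_eventually mult_nonneg_nonneg phi_nonneg)
    show "\<forall>\<^sub>F n in sequentially. real n * phi n r \<le> real n * r ^ n * (1 / (1 - r))"
    proof (intro always_eventually allI)
      fix n
      show "real n * phi n r \<le> real n * r ^ n * (1 / (1 - r))"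
        using mult_left_mono[OF phi_le[of r n], of "real n"] assms by simp
    qed
    have "(\<lambda>n. real n * r ^ n) \<longlonglongrightarrow> 0"
      using powser_times_n_limit_0[of r] assms by simp
    from tendsto_mult_right[OF this, of "1 / (1 - r)"]
    show "(\<lambda>n. real n * r ^ n * (1 / (1 - r))) \<longlonglongrightarrow> 0" by simp
  qed simp
  moreover have "(\<lambda>k. r ^ k) sums (1 / (1 - r))"
    using assms by (intro geometric_sums) auto
  ultimately have "(\<lambda>n. real n * phi n r + (\<Sum>k<n. r ^ k)) \<longlonglongrightarrow> 0 + 1 / (1 - r)"
    unfolding sums_def by (intro tendsto_add)
  then have "(\<lambda>k. phi k r) sums (1 / (1 - r))"
    using assms by (simp add: sums_def sum_phi)
  from sums_split_initial_segment[OF this, of 2]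
  have "(\<lambda>k. phi (k + 2) r) sums (1 / (1 - r) - (phi 0 r + phi 1 r))"
    by (simp add: numeral_2_eq_2)
  moreover have "1 / (1 - r) - (phi 0 r + phi 1 r) = phi_tail r"
    using assms unfolding phi_0_eq[OF assms] phi_1_eq[OF assms] phi_tail_def
    by (simp add: field_simps)
  ultimately show ?thesis by simp
qed

lemma phi_1_pos: "0 < r \<Longrightarrow> r < 1 \<Longrightarrow> 0 < phi 1 r"
  using phi_Suc[of r 1] phi_nonneg[of r 2] by (simp add: numeral_2_eq_2)

text \<open>Division by \<open>x\<close> leaves a power series with positive coefficients, which
  grows termwise.\<close>

lemma phi_1_div_mono:
  assumes "0 < x" "x \<le> y" "y < 1"
  shows "phi 1 x / x \<le> phi 1 y / y"
proof -
  have eq: "phi 1 x / x = (\<Sum>i. x ^ i / real (i + 2))" if "0 < x" "x < 1" for x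
    using suminf_divide[OF summable_phi[of x 1], of x] that by (simp add: phi_def)
  have "summable (\<lambda>i. x ^ i / real (i + 2))" if "0 < x" "x < 1" for x
    using summable_divide[OF summable_phi[of x 1], of x] that by simp
  then show ?thesis
    using assms by (subst (1 2) eq) (auto intro!: suminf_le divide_right_mono power_mono)
qed

lemma phi_1_strict_mono:
  assumes "0 < x" "x < y" "y < 1"
  shows "phi 1 x < phi 1 y"
proof -
  have "phi 1 x = x * (phi 1 x / x)" using assms by simp
  also have "\<dots> < y * (phi 1 x / x)"
    using assms phi_1_pos[of x] by (intro mult_strict_right_mono) auto
  also have "\<dots> \<le> y * (phi 1 y / y)"
    using assms phi_1_div_mono[of x y] by (intro mult_left_mono) auto
  finally show ?thesis using assms by simp
qed

text \<open>Comparing the series for every \<open>phi k\<close> termwise avoids differentiating the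
  closed form.\<close>

lemma phi_tail_strict_mono:
  assumes "0 < x" "x < y" "y < 1"
  shows "phi_tail x < phi_tail y"
proof -
  have strict: "phi k x < phi k y" if "k \<ge> 1" for k
  proof -
    have pw: "x ^ n < y ^ n" if "n \<ge> 1" for n
      using assms that by (intro power_strict_mono) auto
    have "summable (\<lambda>i. y ^ (k + i) / real (k + i + 1) - x ^ (k + i) / real (k + i + 1))"
      using assms by (intro summable_diff summable_phi) auto
    then have "0 < (\<Sum>i. y ^ (k + i) / real (k + i + 1) - x ^ (k + i) / real (k + i + 1))"
      by (rule suminf_pos) (use pw that in \<open>simp add: divide_strict_right_mono\<close>)
    also have "\<dots> = phi k y - phi k x"
      unfolding phi_def
      by (rule suminf_diff[symmetric]; rule summable_phi) (use assms in auto)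
    finally show ?thesis by simp
  qed
  have x: "(\<lambda>k. phi (k + 2) x) sums phi_tail x" and y: "(\<lambda>k. phi (k + 2) y) sums phi_tail y"
    by (rule phi_tail_sums; use assms in simp)+
  have "0 < (\<Sum>k. phi (k + 2) y - phi (k + 2) x)"
    by (rule suminf_pos) (use sums_diff[OF y x] strict in \<open>auto simp: sums_iff\<close>)
  then show ?thesis using sums_diff[OF y x] by (simp add: sums_iff)
qed

section \<open>The logarithmic kernel and elementary bounds for logarithms\<close>

text \<open>The primitive of \<open>4 / ((1 + x)^2 (1 - x))\<close> that vanishes at 0. Divided by
  \<open>x\<close>, it is the expression in braces in the equation for
  \<open>R\<^sub>m\<^sub>,\<^sub>1\<close>.\<close>

definition log_kernel :: "real \<Rightarrow> real" where
  "log_kernel x = - ln (1 - x) + ln (1 + x) + 2 * x / (1 + x)"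

lemma log_kernel_deriv:
  assumes "-1 < x" "x < 1"
  shows "(log_kernel has_real_derivative 4 / ((1 + x)\<^sup>2 * (1 - x))) (at x)"
  unfolding log_kernel_def using assms
  by (auto intro!: derivative_eq_intros)
    (simp add: divide_simps, simp add: algebra_simps power2_eq_square)

lemma log_kernel_mono:
  assumes "0 \<le> x" "x \<le> y" "y < 1"
  shows "log_kernel x \<le> log_kernel y"
proof (rule DERIV_nonneg_imp_nondecreasing[OF assms(2)])
  fix t assume "x \<le> t" "t \<le> y"
  with assms show "\<exists>d. (log_kernel has_real_derivative d) (at t) \<and> 0 \<le> d"
    by (intro exI[of _ "4 / ((1 + t)\<^sup>2 * (1 - t))"] conjI log_kernel_deriv) auto
qed

lemma log_kernel_0: "log_kernel 0 = 0"
  by (simp add: log_kernel_def)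

lemma log_kernel_nonneg: "0 \<le> x \<Longrightarrow> x < 1 \<Longrightarrow> 0 \<le> log_kernel x"
  using log_kernel_mono[of 0 x] by (simp add: log_kernel_0)

lemma ln_one_plus_lower:
  fixes x :: real
  assumes "0 < x"
  shows "x / (1 + x) \<le> ln (1 + x)"
  using ln_le_minus_one[of "1 / (1 + x)"] assms by (simp add: ln_div field_simps)

lemma ln_one_plus_div_antimono:
  fixes x y :: real
  assumes "0 < x" "x \<le> y"
  shows "ln (1 + y) / y \<le> ln (1 + x) / x"
proof (rule DERIV_nonpos_imp_nonincreasing[OF assms(2)])
  fix t assume t: "x \<le> t" "t \<le> y"
  have "((\<lambda>x. ln (1 + x) / x) has_real_derivative (t / (1 + t) - ln (1 + t)) / t\<^sup>2) (at t)"
    using assms t by (auto intro!: derivative_eq_intros simp: divide_simps power2_eq_square)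
  then show "\<exists>d. ((\<lambda>x. ln (1 + x) / x) has_real_derivative d) (at t) \<and> d \<le> 0"
    using ln_one_plus_lower[of t] assms t by (intro exI conjI) (auto simp: divide_nonpos_nonneg)
qed

section \<open>Monotonicity and sign of the gap function\<close>

text \<open>The left-hand side of the equation for \<open>R\<^sub>m\<^sub>,\<^sub>1\<close>, with \<open>x\<close> in place of \<open>r\<^sup>m\<close>.\<close>

definition bohr_gap :: "real \<Rightarrow> real \<Rightarrow> real" where
  "bohr_gap x r = phi 1 x * log_kernel x / (2 * x) + 2 * phi_tail r - ln (1 + x) / x"

lemma bohr_gap_eq:
  assumes "0 < x" "x < 1" "0 < r" "r < 1"
  shows "(- x - ln (1 - x)) / (2 * x)
            * (- (1 / x * ln (1 - x)) + 1 / x * ln (1 + x) + 2 / (1 + x))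
          + 2 * (r ^ 2 / (1 - r) + r + 2 + 2 / r * ln (1 - r))
          - 1 / x * ln (1 + x) = bohr_gap x r"
proof -
  have "- (1 / x * ln (1 - x)) + 1 / x * ln (1 + x) + 2 / (1 + x) = log_kernel x / x"
    using assms by (simp add: log_kernel_def field_simps)
  moreover have "r ^ 2 / (1 - r) + r = r / (1 - r)"
    using assms by (simp add: field_simps power2_eq_square)
  moreover have "(- x - ln (1 - x)) / (2 * x) = phi 1 x / 2"
    unfolding phi_1_eq[OF assms(1,2)] by simp
  ultimately show ?thesis by (simp only: bohr_gap_def phi_tail_def) simp
qed

text \<open>The three summands grow separately; strictness comes from
  \<open>phi_tail\<close>.\<close>

lemma bohr_gap_strict_mono:
  assumes "0 < x" "x \<le> x'" "x' < 1" "0 < r" "r < r'" "r' < 1"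
  shows "bohr_gap x r < bohr_gap x' r'"
proof -
  have "phi 1 x / x * log_kernel x \<le> phi 1 x' / x' * log_kernel x'"
    using assms phi_1_pos[of x'] phi_1_div_mono[of x x'] log_kernel_mono[of x x'] log_kernel_nonneg[of x]
    by (intro mult_mono) auto
  moreover have "phi_tail r < phi_tail r'" using assms by (intro phi_tail_strict_mono) auto
  moreover have "ln (1 + x') / x' \<le> ln (1 + x) / x"
    using assms by (intro ln_one_plus_div_antimono)
  ultimately show ?thesis by (simp add: bohr_gap_def field_simps)
qed

lemma ln_one_minus_bounds:
  fixes x :: real
  assumes "x < 1"
  shows "ln (1 - x) \<le> - x" "- x / (1 - x) \<le> ln (1 - x)"
  using ln_le_minus_one[of "1 - x"] ln_le_minus_one[of "1 / (1 - x)"] assms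
  by (simp_all add: ln_div field_simps)

text \<open>Supplies a left endpoint for the intermediate value theorem that serves all
  \<open>m\<close> at once, as \<open>(1 / 10) ^ m <= 1 / 10\<close>. The three summands are at most
  \<open>19 / 81\<close>, \<open>2 / 9\<close> and \<open>- 10 / 11\<close>.\<close>

lemma bohr_gap_neg:
  assumes "0 < x" "x \<le> 1 / 10"
  shows "bohr_gap x (1 / 10) < 0"
proof -
  have x: "x < 1" using assms by simp
  have "phi 1 x \<le> x / (1 - x)"
    using phi_le[of x 1] assms x by simp
  also have "\<dots> \<le> 1 / 9" using assms by (simp add: field_simps)
  finally have 1: "phi 1 x \<le> 1 / 9" .
  have "- ln (1 - x) \<le> x / (1 - x)" using ln_one_minus_bounds[OF x] by simp
  also have "\<dots> \<le> 10 / 9 * x" using assms by (simp add: field_simps)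
  finally have "- ln (1 - x) \<le> 10 / 9 * x" .
  moreover have "ln (1 + x) \<le> x" using assms by (intro ln_add_one_self_le_self) auto
  moreover have "2 * x / (1 + x) \<le> 2 * x" using assms by (simp add: field_simps)
  ultimately have "log_kernel x \<le> 38 / 9 * x" unfolding log_kernel_def using assms(1) by linarith
  then have "phi 1 x * log_kernel x \<le> 1 / 9 * (38 / 9 * x)"
    using 1 assms log_kernel_nonneg[of x] by (intro mult_mono) auto
  then have "phi 1 x * log_kernel x / (2 * x) \<le> 19 / 81"
    using assms by (simp add: field_simps)
  moreover have "phi_tail (1 / 10) \<le> 1 / 9"
    using ln_one_minus_bounds(1)[of "1 / 10"] by (simp add: phi_tail_def)
  moreover have "10 / 11 \<le> 1 / (1 + x)" using assms by (simp add: field_simps)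
  moreover have "1 / (1 + x) \<le> ln (1 + x) / x"
    using ln_one_plus_lower[OF assms(1)] assms by (simp add: field_simps)
  ultimately show ?thesis unfolding bohr_gap_def by linarith
qed

text \<open>The critical point is about \<open>0.494\<close>; the polynomial that bounds the gap there from below changes sign
  slightly below \<open>12 / 25\<close>. The condition at \<open>12 / 25\<close> is roughly \<open>- ln (13 / 25) < 0.6647\<close>, hence the
  constant \<open>6647 / 20000\<close> below, whose exponential is squared because the quadratic Taylor bound is too
  weak at \<open>0.6647\<close>.\<close>

lemma ex_critical_point:
  "\<exists>x. 12 / 25 < x \<and> x < 1 \<and> phi 1 x = (1 - x\<^sup>2) / 2"
proof -
  \<comment> \<open>On \<open>0 < x < 1\<close> this is \<open>phi 1 x + x\<^sup>2 / 2\<close> in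
    closed form, so the wanted point solves \<open>h x = 1 / 2\<close>.\<close>
  define h where "h x = (- x - ln (1 - x)) / x + x\<^sup>2 / 2" for x :: real
  have "exp (- 6647 / 20000 :: real) ^ 2 < 13 / 25"
  proof -
    have "(1 + 6647 / 20000 + (6647 / 20000)\<^sup>2 / 2 :: real) \<le> exp (6647 / 20000)"
      by (rule exp_lower_Taylor_quadratic) simp
    from power_mono[OF this, of 2]
    have "(25 / 13 :: real) < exp (6647 / 20000) ^ 2" by (simp add: power2_eq_square)
    then show ?thesis by (simp add: exp_minus field_simps)
  qed
  then have "ln (exp (- 6647 / 10000)) < ln (13 / 25 :: real)"
    by (subst ln_less_cancel_iff) (simp_all flip: exp_double)
  then have "- 6647 / 10000 < ln (13 / 25 :: real)" by simp
  moreover have "h (12 / 25) = - 1 - 25 / 12 * ln (13 / 25) + 72 / 625"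
    by (simp add: h_def power2_eq_square diff_divide_distrib)
  ultimately have "h (12 / 25) < 1 / 2" by linarith
  \<comment> \<open>At the right endpoint \<open>1 - 3 / 4 = (1 / 2) ^ 2\<close>, so the crude bound
    \<open>ln (1 / 2) <= - 1 / 2\<close> suffices.\<close>
  have "ln (1 / 4) \<le> (-1 :: real)"
    using ln_le_minus_one[of "1 / 2"] ln_realpow[of "1 / 2" 2] by (simp add: power2_eq_square)
  moreover have "h (3 / 4) = - 1 - 4 / 3 * ln (1 / 4) + 9 / 32"
    by (simp add: h_def power2_eq_square diff_divide_distrib)
  ultimately have "1 / 2 \<le> h (3 / 4)" by linarith
  have "continuous_on {12 / 25..3 / 4} h"
    unfolding h_def by (intro continuous_intros) auto
  with \<open>h (12 / 25) < 1 / 2\<close> \<open>1 / 2 \<le> h (3 / 4)\<close> obtain x where x: "12 / 25 \<le> x" "x \<le> 3 / 4" "h x = 1 / 2"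
    using IVT'[of h "12 / 25" "1 / 2" "3 / 4"] by auto
  with \<open>h (12 / 25) < 1 / 2\<close> have "x \<noteq> 12 / 25" by (metis less_irrefl)
  moreover have "phi 1 x = h x - x\<^sup>2 / 2"
    using x by (subst phi_1_eq) (auto simp: h_def)
  ultimately show ?thesis using x by (intro exI[of _ x]) (auto simp: diff_divide_distrib)
qed

text \<open>At the critical point the logarithm \<open>ln (1 - x)\<close> is a polynomial in \<open>x\<close>.\<close>

lemma bohr_gap_nonneg_at_critical_point:
  assumes x: "12 / 25 < x" "x < 1" "phi 1 x = (1 - x\<^sup>2) / 2" and r: "x \<le> r" "r < 1"
  shows "0 \<le> bohr_gap x r"
proof -
  have x01: "0 < x" "x < 1" using x by auto
  have l: "- ln (1 - x) = x * (1 + (1 - x\<^sup>2) / 2)"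
    using x(3) unfolding phi_1_eq[OF x01] using x01 by (simp add: field_simps)
  define M where "M = ln (1 + x) / x"
  have M: "M \<le> 1" using ln_add_one_self_le_self[of x] x by (simp add: M_def)
  have tail: "phi_tail x = 1 / (1 - x) - 2 + x\<^sup>2"
  proof -
    have "2 / x * ln (1 - x) = - 2 * (1 + (1 - x\<^sup>2) / 2)"
      using l x by (simp add: field_simps)
    then have "phi_tail x = x / (1 - x) + 2 + - 2 * (1 + (1 - x\<^sup>2) / 2)"
      by (simp only: phi_tail_def)
    then show ?thesis using x by (simp add: field_simps)
  qed
  have kern: "log_kernel x / x = 1 + (1 - x\<^sup>2) / 2 + M + 2 / (1 + x)"
    using x unfolding log_kernel_def l M_def by (simp add: add_divide_distrib)
  have "bohr_gap x x = phi 1 x / 2 * (log_kernel x / x) + 2 * phi_tail x - M"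
    by (simp add: bohr_gap_def M_def)
  also have "\<dots> = (1 - x\<^sup>2) / 4 * (1 + (1 - x\<^sup>2) / 2 + M + 2 / (1 + x))
      + 2 * (1 / (1 - x) - 2 + x\<^sup>2) - M"
    unfolding x(3) tail kern by simp
  also have "\<dots> = (1 - x\<^sup>2) / 4 * (1 + (1 - x\<^sup>2) / 2) + (1 - x) / 2
      + 2 * (1 / (1 - x) - 2 + x\<^sup>2) - (3 + x\<^sup>2) / 4 * M"
    using x by (simp add: divide_simps) (simp add: algebra_simps power2_eq_square)
  \<comment> \<open>The coefficient of \<open>M\<close> is negative, so the upper bound
    \<open>M <= 1\<close> gives a lower bound for the gap.\<close>
  also have "\<dots> \<ge> (1 - x\<^sup>2) / 4 * (1 + (1 - x\<^sup>2) / 2) + (1 - x) / 2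
      + 2 * (1 / (1 - x) - 2 + x\<^sup>2) - (3 + x\<^sup>2) / 4"
    using mult_left_mono[OF M, of "(3 + x\<^sup>2) / 4"] by simp
  finally have 1: "(1 - x\<^sup>2) / 4 * (1 + (1 - x\<^sup>2) / 2) + (1 - x) / 2
      + 2 * (1 / (1 - x) - 2 + x\<^sup>2) - (3 + x\<^sup>2) / 4 \<le> bohr_gap x x" .
  have 2: "0 \<le> (1 - x\<^sup>2) / 4 * (1 + (1 - x\<^sup>2) / 2) + (1 - x) / 2
      + 2 * (1 / (1 - x) - 2 + x\<^sup>2) - (3 + x\<^sup>2) / 4"
  proof -
    \<comment> \<open>The cubic \<open>27 * x + 14 * x ^ 2 - 10 * x ^ 3\<close> minus its value at
      \<open>12 / 25\<close> is \<open>x - 12 / 25\<close> times the quadratic below, which is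
      nonnegative here. The subtracted value \<open>235620 / 15625\<close> lies just above
      15.\<close>
    have "x * x \<le> 1" using x01 by (simp add: mult_le_one)
    moreover have "27 + 14 * (x + 12 / 25) - 10 * (x * x + x * (12 / 25) + 144 / 625)
        = 3927 / 125 + 46 / 5 * x - 10 * (x * x)"
      by (simp add: algebra_simps)
    ultimately have "0 \<le> 27 + 14 * (x + 12 / 25) - 10 * (x * x + x * (12 / 25) + 144 / 625)"
      using x01 by linarith
    then have "0 \<le> (x - 12 / 25) * (27 + 14 * (x + 12 / 25) - 10 * (x * x + x * (12 / 25) + 144 / 625))"
      using x by (intro mult_nonneg_nonneg) simp_all
    also have "\<dots> = 27 * x + 14 * x ^ 2 - 10 * x ^ 3 - 235620 / 15625"
      by (simp add: field_simps power2_eq_square power3_eq_cube)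
    finally have "15 \<le> 27 * x + 14 * x ^ 2 - 10 * x ^ 3" by simp
    moreover have "x ^ 5 \<le> x ^ 4" using x01 by (intro power_decreasing) auto
    ultimately have "0 \<le> 27 * x + 14 * x ^ 2 - 10 * x ^ 3 - 15 + x ^ 4 - x ^ 5" by linarith
    then have "0 \<le> (27 * x + 14 * x ^ 2 - 10 * x ^ 3 - 15 + x ^ 4 - x ^ 5) / (8 * (1 - x))"
      using x01 by (intro divide_nonneg_pos) auto
    also have "\<dots> = (1 - x\<^sup>2) / 4 * (1 + (1 - x\<^sup>2) / 2) + (1 - x) / 2
        + 2 * (1 / (1 - x) - 2 + x\<^sup>2) - (3 + x\<^sup>2) / 4"
      using x01 by (simp add: divide_simps) (simp add: algebra_simps eval_nat_numeral)
    finally show ?thesis .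
  qed
  \<comment> \<open>The gap depends on \<open>r\<close> only through \<open>phi_tail\<close>, so the
    diagonal case \<open>r = x\<close>, which is \<open>m = 1\<close>, settles every larger
    \<open>r\<close>, in particular every m-th root of \<open>x\<close>.\<close>
  have "phi_tail x \<le> phi_tail r"
    using phi_tail_strict_mono[of x r] x r by (cases "x = r") auto
  then have "bohr_gap x x \<le> bohr_gap x r" by (simp add: bohr_gap_def)
  with 1 2 show ?thesis by linarith
qed

section \<open>The pointwise majorant and its integral\<close>

text \<open>Both sides are affine in \<open>\<mu>\<close>, so it suffices to compare them at \<open>\<mu> = 0\<close> and
  \<open>\<mu> = (1 - s\<^sup>2) / 2\<close>, where the right-hand side vanishes.\<close>

lemma kernel_ineq:
  fixes a s \<mu> :: real
  assumes a: "0 \<le> a" "a \<le> 1" and s: "0 \<le> s" "s < 1" and \<mu>: "0 \<le> \<mu>" "\<mu> \<le> (1 - s\<^sup>2) / 2"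
  shows "- 1 / (1 + a * s) + (1 + a) * \<mu> / ((1 + a * s)\<^sup>2 * (1 - s))
      \<le> - 1 / (1 + s) + 2 * \<mu> / ((1 + s)\<^sup>2 * (1 - s))"
proof -
  \<comment> \<open>The relative position of \<open>\<mu>\<close> between the endpoints 0 and
    \<open>(1 - s\<^sup>2) / 2\<close>; both sides are split into weights
    \<open>1 - \<theta>\<close> and \<open>\<theta>\<close>.\<close>
  define \<theta> where "\<theta> = 2 * \<mu> / (1 - s\<^sup>2)"
  have s2: "1 - s\<^sup>2 = (1 - s) * (1 + s)" by (simp add: algebra_simps power2_eq_square)
  have pos: "0 < (1 - s) * (1 + s)" using s by simp
  have \<theta>: "0 \<le> \<theta>" "\<theta> \<le> 1" using \<mu> pos by (simp_all add: \<theta>_def s2 field_simps)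
  have as: "0 < 1 + a * s" using a s by (simp add: add_pos_nonneg)
  have \<mu>_eq: "\<mu> = \<theta> * (1 - s) * (1 + s) / 2" using s by (simp add: \<theta>_def s2)
  \<comment> \<open>This is \<open>(1 + a) * (1 + s) <= 2 * (1 + a * s)\<close>, the comparison at
    the endpoint \<open>\<theta> = 1\<close>.\<close>
  have "0 \<le> (1 - a) * (1 - s)" using a s by simp
  then have "(1 + a) * (1 + s) / (2 * (1 + a * s)) \<le> 1" using as by (simp add: field_simps)
  then have "\<theta> / (1 + a * s) * ((1 + a) * (1 + s) / (2 * (1 + a * s)) - 1) \<le> 0"
    using \<theta> as by (intro mult_nonneg_nonpos) auto
  moreover have "(1 - \<theta>) * (1 / (1 + s)) \<le> (1 - \<theta>) * (1 / (1 + a * s))"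
    using a s as \<theta> by (intro mult_left_mono frac_le) (auto simp: mult_left_le_one_le)
  moreover have "- 1 / (1 + a * s) + (1 + a) * \<mu> / ((1 + a * s)\<^sup>2 * (1 - s))
     = - ((1 - \<theta>) * (1 / (1 + a * s))) + \<theta> / (1 + a * s) * ((1 + a) * (1 + s) / (2 * (1 + a * s)) - 1)"
    using as s unfolding \<mu>_eq by (simp add: divide_simps) (simp add: algebra_simps power2_eq_square)
  moreover have "- 1 / (1 + s) + 2 * \<mu> / ((1 + s)\<^sup>2 * (1 - s)) = - ((1 - \<theta>) * (1 / (1 + s)))"
    using s unfolding \<mu>_eq by (simp add: divide_simps) (simp add: algebra_simps power2_eq_square)
  ultimately show ?thesis by linarith
qed

text \<open>Here \<open>y\<close> and \<open>d\<close> stand for the norms of \<open>f\<close> and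
  \<open>deriv f\<close> at one point. As \<open>\<mu> <= (1 - s\<^sup>2) / 2\<close>, the
  Schwarz-Pick bound grows with \<open>y\<close>, so \<open>y\<close> may be replaced by its maximum
  \<open>Y\<close>. Then \<open>1 - a\<close> factors out of the deviation from 1, and
  \<open>kernel_ineq\<close> replaces the remaining \<open>a\<close> by 1.\<close>

lemma schwarz_pick_majorant:
  fixes a s \<mu> y d :: real
  assumes a: "0 \<le> a" "a \<le> 1" and s: "0 \<le> s" "s < 1" and \<mu>: "0 \<le> \<mu>" "\<mu> \<le> (1 - s\<^sup>2) / 2"
    and y: "0 \<le> y" "y \<le> (a + s) / (1 + a * s)" and d: "d \<le> (1 - y\<^sup>2) / (1 - s\<^sup>2)"
  shows "(y + \<mu> * d) / (1 - s)
      \<le> 1 / (1 - s) + (1 - a) * (- 1 / (1 + s) + 2 * \<mu> / ((1 + s)\<^sup>2 * (1 - s)))"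
proof -
  define Y where "Y = (a + s) / (1 + a * s)"
  have as: "0 < 1 + a * s" using a s by (simp add: add_pos_nonneg)
  have "0 \<le> (1 - a) * (1 - s)" using a s by simp
  then have Y1: "Y \<le> 1" using as by (simp add: Y_def field_simps)
  have s2: "0 < 1 - s\<^sup>2" using s by (simp add: abs_square_less_1)
  have "y + \<mu> * d \<le> y + \<mu> * ((1 - y\<^sup>2) / (1 - s\<^sup>2))"
    using d \<mu> by (intro add_left_mono mult_left_mono)
  also have "\<dots> \<le> Y + \<mu> * ((1 - Y\<^sup>2) / (1 - s\<^sup>2))"
  proof -
    have "\<mu> / (1 - s\<^sup>2) * (Y + y) \<le> 1 / 2 * 2"
      using \<mu> s2 y Y1 a s as by (intro mult_mono) (auto simp: field_simps Y_def)
    then have "0 \<le> (Y - y) * (1 - \<mu> / (1 - s\<^sup>2) * (Y + y))"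
      using y by (intro mult_nonneg_nonneg) (auto simp: Y_def)
    also have "\<dots> = Y + \<mu> * ((1 - Y\<^sup>2) / (1 - s\<^sup>2)) - (y + \<mu> * ((1 - y\<^sup>2) / (1 - s\<^sup>2)))"
      using s2 by (simp add: divide_simps) (simp add: algebra_simps power2_eq_square)
    finally show ?thesis by simp
  qed
  also have "(1 - Y\<^sup>2) / (1 - s\<^sup>2) = (1 - a) * (1 + a) / (1 + a * s)\<^sup>2"
    using as s2 by (simp add: Y_def divide_simps) (simp add: algebra_simps power2_eq_square)
  also have "Y = 1 - (1 - a) * (1 - s) / (1 + a * s)"
    using as by (simp add: Y_def field_simps)
  finally have "(y + \<mu> * d) / (1 - s) \<le> (1 - (1 - a) * (1 - s) / (1 + a * s)
      + \<mu> * ((1 - a) * (1 + a) / (1 + a * s)\<^sup>2)) / (1 - s)"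
    using s by (intro divide_right_mono) auto
  also have "\<dots> = 1 / (1 - s)
      + (1 - a) * (- 1 / (1 + a * s) + (1 + a) * \<mu> / ((1 + a * s)\<^sup>2 * (1 - s)))"
    using as s by (simp add: divide_simps) (simp add: algebra_simps power2_eq_square)
  also have "\<dots> \<le> 1 / (1 - s) + (1 - a) * (- 1 / (1 + s) + 2 * \<mu> / ((1 + s)\<^sup>2 * (1 - s)))"
    using kernel_ineq[OF a s \<mu>] a by (intro add_left_mono mult_left_mono) auto
  finally show ?thesis .
qed

text \<open>The parameters are free because the integral serves twice: with \<open>c = 1 - a\<close>
  for the upper bound, and with adjusted \<open>c\<close> and \<open>\<mu>\<close> for the lower
  bound on the extremal function.\<close>

lemma has_integral_majorant:
  fixes x \<mu> c :: real
  assumes x: "0 < x" "x < 1"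
  shows "((\<lambda>t. 1 / (1 - t * x)
      + c * (- 1 / (1 + t * x) + 2 * \<mu> / ((1 + t * x)\<^sup>2 * (1 - t * x))))
    has_integral (- ln (1 - x) / x + c * (\<mu> * log_kernel x / (2 * x) - ln (1 + x) / x))) {0..1}"
proof -
  define F where "F t = (- ln (1 - t * x) + c * (\<mu> / 2 * log_kernel (t * x) - ln (1 + t * x))) / x" for t
  have "((\<lambda>t. 1 / (1 - t * x)
      + c * (- 1 / (1 + t * x) + 2 * \<mu> / ((1 + t * x)\<^sup>2 * (1 - t * x)))) has_integral F 1 - F 0) {0..1}"
  proof (rule fundamental_theorem_of_calculus)
    fix t :: real assume t: "t \<in> {0..1}"
    then have tx: "0 \<le> t * x" "t * x < 1"
      using x by (auto intro: order.strict_trans1[OF mult_left_le_one_le])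
    have k: "((\<lambda>t. log_kernel (t * x)) has_real_derivative
        4 / ((1 + t * x)\<^sup>2 * (1 - t * x)) * x) (at t)"
      by (rule DERIV_chain2[OF log_kernel_deriv]) (use tx in \<open>auto intro!: derivative_eq_intros\<close>)
    have "(F has_real_derivative (1 / (1 - t * x)
        + c * (- 1 / (1 + t * x) + 2 * \<mu> / ((1 + t * x)\<^sup>2 * (1 - t * x))))) (at t)"
      unfolding F_def using tx x
      by (auto intro!: derivative_eq_intros k) (auto simp: divide_simps, auto simp: algebra_simps power2_eq_square)
    then show "(F has_vector_derivative (1 / (1 - t * x)
        + c * (- 1 / (1 + t * x) + 2 * \<mu> / ((1 + t * x)\<^sup>2 * (1 - t * x))))) (at t within {0..1})"
      by (simp add: has_real_derivative_iff_has_vector_derivative has_vector_derivative_at_within)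
  qed simp
  moreover have "F 1 - F 0 = - ln (1 - x) / x + c * (\<mu> * log_kernel x / (2 * x) - ln (1 + x) / x)"
    using x by (simp add: F_def log_kernel_0 diff_divide_distrib right_diff_distrib)
  ultimately show ?thesis by simp
qed

text \<open>Rewrites the equation for \<open>R\<^sub>m\<close> as a level set of an increasing
  function, which yields uniqueness.\<close>

lemma critical_point_iff:
  assumes "0 < x" "x < 1"
  shows "2 * (- x - ln (1 - x)) = x * (1 - x\<^sup>2) \<longleftrightarrow> phi 1 x + x\<^sup>2 / 2 = 1 / 2"
  unfolding phi_1_eq[OF assms] using assms by (auto simp: field_simps)

text \<open>\<open>phi\<close> is defined by a series, so continuity is taken from the explicit
  logarithmic formula.\<close>

lemma continuous_on_bohr_gap:
  assumes m: "m \<ge> 1"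
  shows "continuous_on {0<..<1} (\<lambda>r. bohr_gap (r ^ m) r)"
proof -
  have x: "0 < r ^ m" "r ^ m < 1" if "r \<in> {0<..<1}" for r :: real
    using that m by (auto simp: power_less_one_iff)
  have nz: "r \<noteq> 0" "r ^ m \<noteq> 0" "1 - r ^ m \<noteq> 0" "1 + r ^ m \<noteq> 0" "1 - r \<noteq> 0" "r \<noteq> 1" "r ^ m \<noteq> 1"
    if "0 < r \<and> r < 1" for r :: real
  proof -
    have "0 < r ^ m" "r ^ m < 1" "0 < r" "r < 1" using x[of r] that by auto
    then show "r \<noteq> 0" "r ^ m \<noteq> 0" "1 - r ^ m \<noteq> 0" "1 + r ^ m \<noteq> 0" "1 - r \<noteq> 0" "r \<noteq> 1" "r ^ m \<noteq> 1"
      by linarith+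
  qed
  have "continuous_on {0<..<1} (\<lambda>r::real. (- (r ^ m) - ln (1 - r ^ m)) / (2 * r ^ m)
            * (- (1 / r ^ m * ln (1 - r ^ m)) + 1 / r ^ m * ln (1 + r ^ m) + 2 / (1 + r ^ m))
          + 2 * (r ^ 2 / (1 - r) + r + 2 + 2 / r * ln (1 - r))
          - 1 / r ^ m * ln (1 + r ^ m))"
    by (intro continuous_intros) (simp_all add: nz)
  then show ?thesis
    by (rule continuous_on_eq, intro bohr_gap_eq) (use x in auto)
qed

section \<open>The Bohr inequality\<close>

text \<open>Lets a sum of norms of two integrals become a single integral with nonnegative real
  value.\<close>

lemma ex_unit_rotation: "\<exists>u. norm u = 1 \<and> u * c = of_real (norm c)" for c :: complex
proof (cases "c = 0")
  case False
  then show ?thesis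
    by (intro exI[of _ "cnj c / of_real (norm c)"])
      (simp add: norm_divide mult.commute power2_eq_square flip: complex_norm_square)
qed (auto intro: exI[of _ 1])

lemma moebius_majorant_mono:
  fixes a p s :: real
  assumes "0 \<le> a" "a \<le> 1" "0 \<le> p" "p \<le> s"
  shows "(a + p) / (1 + a * p) \<le> (a + s) / (1 + a * s)"
proof -
  have "0 \<le> (1 - a\<^sup>2) * (s - p)" using assms by (simp add: power_le_one)
  moreover have "0 < 1 + a * p" "0 < 1 + a * s" using assms by (simp_all add: add_pos_nonneg)
  ultimately show ?thesis by (simp add: divide_simps) (simp add: algebra_simps power2_eq_square)
qed

text \<open>The two Cesaro integrals are rotated onto the nonnegative axis and merged into one, so
  that \<open>f\<close> and \<open>deriv f\<close> are bounded jointly at each point; separate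
  bounds would lose the interplay in Schwarz-Pick.\<close>

lemma cesaro_schur_class_bound:
  assumes f: "f \<in> schur_class" and w: "norm w \<le> x" and x: "0 < x" "x < 1"
    and le: "phi 1 x \<le> (1 - x\<^sup>2) / 2"
  shows "norm (cesaro f w) + norm (cesaro (deriv f) w) * phi 1 x
      \<le> - ln (1 - x) / x
        + (1 - norm (f 0)) * (phi 1 x * log_kernel x / (2 * x) - ln (1 + x) / x)"
proof -
  define \<mu> where "\<mu> = phi 1 x"
  define a where "a = norm (f 0)"
  have hol: "f holomorphic_on ball 0 1" and f1: "\<And>z. norm z < 1 \<Longrightarrow> norm (f z) \<le> 1"
    using f by (auto simp: schur_class_def)
  have \<mu>: "0 \<le> \<mu>" using phi_nonneg[of x 1] x by (simp add: \<mu>_def)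
  have a: "0 \<le> a" "a \<le> 1" using f1[of 0] by (auto simp: a_def)
  obtain u where u: "norm u = 1" "u * cesaro f w = of_real (norm (cesaro f w))"
    using ex_unit_rotation by blast
  obtain v where v: "norm v = 1" "v * cesaro (deriv f) w = of_real (norm (cesaro (deriv f) w))"
    using ex_unit_rotation by blast
  define F where "F t = u * (f (of_real t * w) / (1 - of_real t * w))
      + of_real \<mu> * v * (deriv f (of_real t * w) / (1 - of_real t * w))" for t :: real
  have w1: "norm w < 1" using w x by simp
  have "(F has_integral u * cesaro f w + of_real \<mu> * v * cesaro (deriv f) w) {0..1}"
    unfolding F_def
    by (intro has_integral_add has_integral_mult_right cesaro_integral hol holomorphic_deriv w1) auto
  also have "u * cesaro f w + of_real \<mu> * v * cesaro (deriv f) w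
      = of_real (norm (cesaro f w) + norm (cesaro (deriv f) w) * \<mu>)"
    using u(2) v(2) by (simp add: mult_ac)
  finally have F: "(F has_integral of_real (norm (cesaro f w) + norm (cesaro (deriv f) w) * \<mu>)) {0..1}" .
  have bound: "norm (F t) \<le> 1 / (1 - t * x)
      + (1 - a) * (- 1 / (1 + t * x) + 2 * \<mu> / ((1 + t * x)\<^sup>2 * (1 - t * x)))"
    if t: "t \<in> {0..1}" for t
  proof -
    define \<zeta> where "\<zeta> = of_real t * w"
    \<comment> \<open>The radius is enlarged from \<open>norm \<zeta>\<close> to
      \<open>t * x\<close>, which makes the majorant independent of \<open>w\<close>; every estimate
      below is monotone in the radius.\<close>
    define s where "s = t * x"
    have s: "0 \<le> s" "s \<le> x" using t x by (auto simp: s_def mult_left_le_one_le)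
    have \<zeta>s: "norm \<zeta> \<le> s" using t w by (simp add: \<zeta>_def s_def norm_mult mult_left_mono)
    then have \<zeta>1: "norm \<zeta> < 1" using s x by simp
    have "s\<^sup>2 \<le> x\<^sup>2" using s by (intro power_mono)
    then have \<mu>s: "\<mu> \<le> (1 - s\<^sup>2) / 2" using le by (simp add: \<mu>_def)
    have y: "norm (f \<zeta>) \<le> (a + s) / (1 + a * s)"
      using schur_class_norm_bound[OF f \<zeta>1] moebius_majorant_mono[OF a _ \<zeta>s]
      by (simp add: a_def)
    have "norm (deriv f \<zeta>) \<le> (1 - (norm (f \<zeta>))\<^sup>2) / (1 - (norm \<zeta>)\<^sup>2)"
      by (rule schwarz_pick_deriv[OF f \<zeta>1])
    also have "\<dots> \<le> (1 - (norm (f \<zeta>))\<^sup>2) / (1 - s\<^sup>2)"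
    proof (rule divide_left_mono)
      show "0 \<le> 1 - (norm (f \<zeta>))\<^sup>2" using f1[OF \<zeta>1] by (simp add: power_le_one)
      show "1 - s\<^sup>2 \<le> 1 - (norm \<zeta>)\<^sup>2" using \<zeta>s by (simp add: power_mono)
      show "0 < (1 - (norm \<zeta>)\<^sup>2) * (1 - s\<^sup>2)"
        using \<zeta>1 s x by (intro mult_pos_pos) (auto simp: abs_square_less_1)
    qed
    finally have d: "norm (deriv f \<zeta>) \<le> (1 - (norm (f \<zeta>))\<^sup>2) / (1 - s\<^sup>2)" .
    have "1 - s \<le> norm (1 - \<zeta>)"
      using norm_triangle_ineq2[of 1 \<zeta>] \<zeta>s by simp
    have "F t = (u * f \<zeta> + of_real \<mu> * v * deriv f \<zeta>) / (1 - \<zeta>)"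
      by (simp add: F_def \<zeta>_def add_divide_distrib)
    then have "norm (F t) = norm (u * f \<zeta> + of_real \<mu> * v * deriv f \<zeta>) / norm (1 - \<zeta>)"
      by (simp add: norm_divide)
    also have "\<dots> \<le> (norm (f \<zeta>) + \<mu> * norm (deriv f \<zeta>)) / (1 - s)"
    proof (rule frac_le)
      show "norm (u * f \<zeta> + of_real \<mu> * v * deriv f \<zeta>) \<le> norm (f \<zeta>) + \<mu> * norm (deriv f \<zeta>)"
        by (rule norm_triangle_le) (use u v \<mu> in \<open>simp add: norm_mult\<close>)
    qed (use s x \<mu> \<open>1 - s \<le> norm (1 - \<zeta>)\<close> in auto)
    also have "\<dots> \<le> 1 / (1 - s) + (1 - a) * (- 1 / (1 + s) + 2 * \<mu> / ((1 + s)\<^sup>2 * (1 - s)))"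
      by (rule schwarz_pick_majorant) (use a s x \<mu> \<mu>s y d in auto)
    finally show ?thesis by (simp add: s_def)
  qed
  note G = has_integral_majorant[OF x, of "1 - a" \<mu>]
  have "norm (integral {0..1} F) \<le> integral {0..1} (\<lambda>t. 1 / (1 - t * x)
      + (1 - a) * (- 1 / (1 + t * x) + 2 * \<mu> / ((1 + t * x)\<^sup>2 * (1 - t * x))))"
    using F G bound by (intro integral_norm_bound_integral) (auto intro: has_integral_integrable)
  then show ?thesis
    unfolding integral_unique[OF F] integral_unique[OF G] norm_of_real
    by (simp add: a_def \<mu>_def)
qed

lemma taylor_sum_bound:
  assumes f: "f \<in> schur_class" and r: "0 < r" "r < 1"
  shows "(\<Sum>k. norm (taylor_coeff f (k + 2)) * phi (k + 2) r) \<le> 2 * (1 - norm (f 0)) * phi_tail r"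
proof -
  define a where "a = norm (f 0)"
  have a: "0 \<le> a" "a \<le> 1" using f by (auto simp: a_def schur_class_def)
  have "(\<Sum>k. norm (taylor_coeff f (k + 2)) * phi (k + 2) r) \<le> (1 - a\<^sup>2) * phi_tail r"
  proof -
    have le: "norm (taylor_coeff f (k + 2)) * phi (k + 2) r \<le> (1 - a\<^sup>2) * phi (k + 2) r" for k
      unfolding a_def
      by (intro mult_right_mono schur_class_taylor_coeff_bound[OF f] phi_nonneg) (use r in auto)
    have S: "(\<lambda>k. (1 - a\<^sup>2) * phi (k + 2) r) sums ((1 - a\<^sup>2) * phi_tail r)"
      by (intro sums_mult phi_tail_sums r)
    have nn: "0 \<le> norm (taylor_coeff f (k + 2)) * phi (k + 2) r" for k
      using r by (intro mult_nonneg_nonneg phi_nonneg) auto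
    have "summable (\<lambda>k. norm (taylor_coeff f (k + 2)) * phi (k + 2) r)"
      by (rule summable_comparison_test'[OF sums_summable[OF S], of 0])
        (use le nn in \<open>simp only: real_norm_def abs_of_nonneg\<close>)
    then show ?thesis
      using suminf_le[OF le _ sums_summable[OF S]] sums_unique[OF S] by simp
  qed
  also have "\<dots> \<le> 2 * (1 - a) * phi_tail r"
  proof (rule mult_right_mono)
    \<comment> \<open>The difference of the two sides is \<open>(1 - a)^2\<close>. The linear bound
      lets \<open>1 - a\<close> factor out of the whole excess.\<close>
    have "0 \<le> (1 - a) * (1 - a)" using a by simp
    then show "1 - a\<^sup>2 \<le> 2 * (1 - a)" by (simp add: algebra_simps power2_eq_square)
    show "0 \<le> phi_tail r"
      using sums_le[OF _ sums_zero phi_tail_sums[OF r]] phi_nonneg r by simp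
  qed
  finally show ?thesis by (simp add: a_def)
qed

text \<open>After adding the Cesaro and the coefficient estimates, the coefficient of
  \<open>1 - norm (f 0)\<close> is exactly \<open>bohr_gap\<close>.\<close>

lemma cesaro_bohr_ineq_if_bohr_gap_nonpos:
  assumes f: "f \<in> schur_class" and \<omega>: "\<omega> \<in> schur_class_ord m" and m: "m \<ge> 1"
    and z: "z \<noteq> 0" "norm z < 1"
    and le: "phi 1 (norm z ^ m) \<le> (1 - (norm z ^ m)\<^sup>2) / 2"
    and gap: "bohr_gap (norm z ^ m) (norm z) \<le> 0"
  shows "cesaro_bohr_ineq m f \<omega> z"
proof -
  define x where "x = norm z ^ m"
  have x: "0 < x" "x < 1" using z m by (auto simp: x_def power_less_one_iff)
  have "norm (cesaro f (\<omega> z)) + norm (cesaro (deriv f) (\<omega> z)) * phi 1 x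
      + (\<Sum>k. norm (taylor_coeff f (k + 2)) * phi (k + 2) (norm z))
    \<le> - ln (1 - x) / x
        + (1 - norm (f 0)) * (phi 1 x * log_kernel x / (2 * x) - ln (1 + x) / x)
      + 2 * (1 - norm (f 0)) * phi_tail (norm z)"
    using schur_class_ord_bound[OF \<omega> z(2)] x z le
    by (intro add_mono cesaro_schur_class_bound taylor_sum_bound f) (auto simp: x_def)
  also have "\<dots> = - ln (1 - x) / x + (1 - norm (f 0)) * bohr_gap x (norm z)"
    by (simp add: bohr_gap_def algebra_simps)
  also have "\<dots> \<le> - ln (1 - x) / x"
    using gap f by (auto simp: x_def schur_class_def intro!: mult_nonneg_nonpos)
  also have "\<dots> = log_quot x" using x by (simp add: log_quot_def ln_div)
  finally show ?thesis by (simp add: cesaro_bohr_ineq_def x_def)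
qed

text \<open>At the origin every \<open>phi\<close> term vanishes and \<open>log_quot 0 = 1\<close>,
  which leaves \<open>norm (f 0) <= 1\<close>.\<close>

lemma cesaro_bohr_ineq_0:
  assumes f: "f \<in> schur_class" and \<omega>: "\<omega> \<in> schur_class_ord m" and m: "m \<ge> 1"
  shows "cesaro_bohr_ineq m f \<omega> 0"
proof -
  have "\<omega> 0 = 0" using \<omega> m by (force simp: schur_class_ord_def)
  moreover have "phi (Suc k) 0 = 0" for k by (simp add: phi_def)
  moreover have "cesaro f 0 = f 0"
    unfolding cesaro_def by (subst powser_zero) simp
  ultimately show ?thesis
    using f m by (simp add: cesaro_bohr_ineq_def log_quot_def power_0_left schur_class_def)
qed

section \<open>Sharpness\<close>

lemma monomial_in_schur_class_ord: "(\<lambda>z. z ^ m) \<in> schur_class_ord m"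
proof -
  have "taylor_coeff (\<lambda>z. z ^ m) j = (if j = m then 1 else 0)" for j
  proof (rule taylor_coeff_unique)
    fix z :: complex
    have "(\<lambda>n. (if n = m then 1 else 0) * z ^ n) = (\<lambda>n. if n = m then z ^ n else 0)" by auto
    then show "(\<lambda>n. (if n = m then 1 else 0) * z ^ n) sums z ^ m"
      using sums_single[of m "\<lambda>n. z ^ n"] by simp
  qed
  then have "(deriv ^^ j) (\<lambda>z::complex. z ^ m) 0 = (if j = m then fact m else 0)" for j
    by (auto simp: taylor_coeff_def divide_simps split: if_splits)
  then show ?thesis
    by (auto simp: schur_class_ord_def schur_class_def norm_power power_le_one intro!: holomorphic_intros)
qed

definition disc_auto :: "real \<Rightarrow> complex \<Rightarrow> complex" where
  "disc_auto a z = (of_real a + z) / (1 + of_real a * z)"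

lemma disc_auto_denominator:
  assumes "0 \<le> a" "a < 1" "norm z < 1"
  shows "1 + complex_of_real a * z \<noteq> 0"
proof -
  have "norm (complex_of_real a * z) < 1"
    using assms norm_mult_less[of "complex_of_real a" 1 z 1] by simp
  then show ?thesis by (metis add_eq_0_iff norm_minus_cancel norm_one less_irrefl)
qed

lemma disc_auto_in_schur_class:
  assumes "0 \<le> a" "a < 1"
  shows "disc_auto a \<in> schur_class"
proof -
  have "disc_auto a = Moebius_function 0 (- of_real a)"
    by (simp add: fun_eq_iff disc_auto_def Moebius_function_def add.commute)
  then show ?thesis
    using assms Moebius_function_holomorphic[of "- complex_of_real a" 0]
      Moebius_function_norm_lt_1[of "- complex_of_real a" _ 0]
    by (auto simp: schur_class_def intro: less_imp_le)
qed

lemma deriv_disc_auto: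
  assumes "0 \<le> a" "a < 1" "norm z < 1"
  shows "deriv (disc_auto a) z = of_real (1 - a\<^sup>2) / (1 + of_real a * z)\<^sup>2"
  unfolding disc_auto_def using disc_auto_denominator[OF assms]
  by (intro DERIV_imp_deriv) (auto intro!: derivative_eq_intros simp: field_simps power2_eq_square)

text \<open>Expands \<open>(a + z) / (1 + a * z) = a + (1 - a^2) * z / (1 + a * z)\<close> by the
  geometric series.\<close>

lemma norm_taylor_coeff_disc_auto:
  assumes a: "0 \<le> a" "a < 1"
  shows "norm (taylor_coeff (disc_auto a) (Suc k)) = (1 - a\<^sup>2) * a ^ k"
proof -
  define c :: "nat \<Rightarrow> complex"
    where "c n = (case n of 0 \<Rightarrow> of_real a | Suc n \<Rightarrow> of_real (1 - a\<^sup>2) * (- of_real a) ^ n)" for n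
  have "taylor_coeff (disc_auto a) (Suc k) = c (Suc k)"
  proof (rule taylor_coeff_unique)
    fix z :: complex assume z: "norm z < 1"
    have "norm (complex_of_real a * z) < 1"
      using a z norm_mult_less[of "complex_of_real a" 1 z 1] by simp
    then have "(\<lambda>n. (- of_real a * z) ^ n) sums (1 / (1 - (- of_real a * z)))"
      by (intro geometric_sums) simp
    from sums_mult[OF this, of "of_real (1 - a\<^sup>2) * z", unfolded power_mult_distrib]
    have "(\<lambda>n. c (Suc n) * z ^ Suc n) sums (of_real (1 - a\<^sup>2) * z / (1 + of_real a * z))"
      by (simp add: c_def mult_ac)
    then have "(\<lambda>n. c n * z ^ n) sums (of_real (1 - a\<^sup>2) * z / (1 + of_real a * z) + of_real a)"
      by (subst (asm) sums_Suc_iff) (simp add: c_def)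
    also have "of_real (1 - a\<^sup>2) * z / (1 + of_real a * z) + of_real a = disc_auto a z"
      using disc_auto_denominator[OF a z]
      by (simp add: disc_auto_def field_simps power2_eq_square)
    finally show "(\<lambda>n. c n * z ^ n) sums disc_auto a z" .
  qed
  moreover have "\<bar>1 - a\<^sup>2\<bar> = 1 - a\<^sup>2" using a by (simp add: power_le_one)
  ultimately show ?thesis
    using a by (simp only: c_def nat.case norm_mult norm_of_real norm_power norm_minus_cancel abs_of_pos
        abs_of_nonneg)
qed

text \<open>On the positive axis all integrands are real. The bounds
  \<open>a * (1 + s) <= 1 + a * s <= 1 + s\<close> reduce them to the earlier majorant, at the cost
  of the factors \<open>1 / a\<close> and \<open>(1 + a) / 2\<close>, which tend to 1 with
  \<open>a\<close>.\<close>

lemma cesaro_disc_auto_lower: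
  assumes a: "0 < a" "a < 1" and x: "0 < x" "x < 1"
  shows "- ln (1 - x) / x
      + (1 - a) * ((1 + a) / 2 * (phi 1 x * log_kernel x / (2 * x)) - ln (1 + x) / (a * x))
    \<le> norm (cesaro (disc_auto a) (of_real x)) + norm (cesaro (deriv (disc_auto a)) (of_real x)) * phi 1 x"
proof -
  define \<mu> where "\<mu> = phi 1 x"
  have \<mu>: "0 \<le> \<mu>" using phi_nonneg[of x 1] x by (simp add: \<mu>_def)
  have hol: "disc_auto a holomorphic_on ball 0 1"
    using disc_auto_in_schur_class[of a] a by (simp add: schur_class_def)
  have "((\<lambda>t. Re (disc_auto a (of_real t * of_real x) / (1 - of_real t * of_real x))
        + \<mu> * Re (deriv (disc_auto a) (of_real t * of_real x) / (1 - of_real t * of_real x)))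
      has_integral Re (cesaro (disc_auto a) (of_real x))
        + \<mu> * Re (cesaro (deriv (disc_auto a)) (of_real x))) {0..1}"
    using x by (intro has_integral_add has_integral_mult_right has_integral_Re
        cesaro_integral hol holomorphic_deriv) auto
  \<comment> \<open>The product of the chosen parameters is
    \<open>\<mu> * (1 - a\<^sup>2) / 2\<close>, matching the numerator of the derivative, while
    \<open>c = (1 - a) / a\<close> matches the bound \<open>1 / (a * (1 + s))\<close>.\<close>
  note * = has_integral_le[OF has_integral_majorant[OF x, of "(1 - a) / a" "\<mu> * a * (1 + a) / 2"] this]
  have "- ln (1 - x) / x + (1 - a) / a * (\<mu> * a * (1 + a) / 2 * log_kernel x / (2 * x) - ln (1 + x) / x)
      \<le> Re (cesaro (disc_auto a) (of_real x)) + \<mu> * Re (cesaro (deriv (disc_auto a)) (of_real x))"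
  proof (rule *)
    fix t :: real assume t: "t \<in> {0..1}"
    define s where "s = t * x"
    have s: "0 \<le> s" "s < 1"
      using t x by (auto simp: s_def intro: order.strict_trans1[OF mult_left_le_one_le])
    have as: "0 < 1 + a * s" using a s by (simp add: add_pos_nonneg)
    have Re1: "Re (disc_auto a (of_real s) / (1 - of_real s)) = (a + s) / (1 + a * s) / (1 - s)"
    proof -
      have "disc_auto a (of_real s) / (1 - of_real s) = of_real ((a + s) / (1 + a * s) / (1 - s))"
        by (simp add: disc_auto_def)
      then show ?thesis by (metis Re_complex_of_real)
    qed
    have Re2: "Re (deriv (disc_auto a) (of_real s) / (1 - of_real s))
        = (1 - a\<^sup>2) / (1 + a * s)\<^sup>2 / (1 - s)"
    proof -
      have "deriv (disc_auto a) (of_real s) / (1 - of_real s)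
          = of_real ((1 - a\<^sup>2) / (1 + a * s)\<^sup>2 / (1 - s))"
        using a s by (subst deriv_disc_auto) auto
      then show ?thesis by (metis Re_complex_of_real)
    qed
    have "1 / (1 + a * s) \<le> 1 / (a * (1 + s))"
      using a s by (intro frac_le mult_pos_pos) (auto simp: algebra_simps)
    then have "(1 - a) * (1 / (1 + a * s)) \<le> (1 - a) * (1 / (a * (1 + s)))"
      using a by (intro mult_left_mono) auto
    moreover have "(a + s) / (1 + a * s) / (1 - s) = 1 / (1 - s) - (1 - a) * (1 / (1 + a * s))"
      using as s by (simp add: divide_simps) (simp add: algebra_simps)
    ultimately have 1: "1 / (1 - s) - (1 - a) * (1 / (a * (1 + s))) \<le> (a + s) / (1 + a * s) / (1 - s)"
      by simp
    have "(1 + a * s)\<^sup>2 \<le> (1 + s)\<^sup>2"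
      using a s by (intro power_mono) (auto simp: mult_left_le_one_le)
    then have "\<mu> * (1 - a\<^sup>2) / (1 + s)\<^sup>2 / (1 - s) \<le> \<mu> * (1 - a\<^sup>2) / (1 + a * s)\<^sup>2 / (1 - s)"
      using \<mu> a s as by (intro divide_right_mono divide_left_mono) (auto simp: power_le_one)
    moreover have "1 / (1 - s) + (1 - a) / a * (- 1 / (1 + s) + 2 * (\<mu> * a * (1 + a) / 2) / ((1 + s)\<^sup>2 * (1 - s)))
        = 1 / (1 - s) - (1 - a) * (1 / (a * (1 + s))) + \<mu> * (1 - a\<^sup>2) / (1 + s)\<^sup>2 / (1 - s)"
      using a s by (simp add: divide_simps) (simp add: algebra_simps power2_eq_square)
    ultimately have "1 / (1 - s) + (1 - a) / a * (- 1 / (1 + s) + 2 * (\<mu> * a * (1 + a) / 2) / ((1 + s)\<^sup>2 * (1 - s)))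
        \<le> Re (disc_auto a (of_real s) / (1 - of_real s))
          + \<mu> * Re (deriv (disc_auto a) (of_real s) / (1 - of_real s))"
      unfolding Re1 Re2 using 1 by simp
    then show "1 / (1 - t * x) + (1 - a) / a * (- 1 / (1 + t * x)
          + 2 * (\<mu> * a * (1 + a) / 2) / ((1 + t * x)\<^sup>2 * (1 - t * x)))
        \<le> Re (disc_auto a (of_real t * of_real x) / (1 - of_real t * of_real x))
          + \<mu> * Re (deriv (disc_auto a) (of_real t * of_real x) / (1 - of_real t * of_real x))"
      by (simp only: s_def of_real_mult)
  qed
  also have "\<dots> \<le> norm (cesaro (disc_auto a) (of_real x)) + norm (cesaro (deriv (disc_auto a)) (of_real x)) * \<mu>"
    using \<mu> complex_Re_le_cmod
    by (subst mult.commute[of "norm (cesaro (deriv _) _)"]) (intro add_mono mult_left_mono)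
  also have "(1 - a) / a * (\<mu> * a * (1 + a) / 2 * log_kernel x / (2 * x) - ln (1 + x) / x)
      = (1 - a) * ((1 + a) / 2 * (\<mu> * log_kernel x / (2 * x)) - ln (1 + x) / (a * x))"
    using a x by (simp add: divide_simps)
  finally show ?thesis by (simp add: \<mu>_def)
qed

lemma not_cesaro_bohr_ineq_if_bohr_gap_pos:
  assumes m: "m \<ge> 1" and r: "0 < r" "r < 1" and gap: "0 < bohr_gap (r ^ m) r"
  obtains a where "0 < a" "a < 1" "\<not> cesaro_bohr_ineq m (disc_auto a) (\<lambda>z. z ^ m) (of_real r)"
proof -
  define x where "x = r ^ m"
  have x: "0 < x" "x < 1" using r m by (auto simp: x_def power_less_one_iff)
  \<comment> \<open>\<open>(1 - a) * E N a\<close> bounds the excess from below, with the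
    coefficient series cut after \<open>N\<close> terms so that the limit in \<open>a\<close>
    concerns a finite sum.\<close>
  define E where "E N a = (1 + a) / 2 * (phi 1 x * log_kernel x / (2 * x)) - ln (1 + x) / (a * x)
      + (1 + a) * (\<Sum>k<N. a ^ Suc k * phi (k + 2) r)" for N a
  \<comment> \<open>First \<open>N\<close> is fixed so that the truncated gap is still positive;
    only then is \<open>a\<close> chosen close to 1.\<close>
  have "(\<lambda>N. phi 1 x * log_kernel x / (2 * x) - ln (1 + x) / x + 2 * (\<Sum>k<N. phi (k + 2) r))
      \<longlonglongrightarrow> phi 1 x * log_kernel x / (2 * x) - ln (1 + x) / x + 2 * phi_tail r"
    using phi_tail_sums[OF r] unfolding sums_def by (intro tendsto_intros)
  also have "phi 1 x * log_kernel x / (2 * x) - ln (1 + x) / x + 2 * phi_tail r = bohr_gap x r"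
    by (simp add: bohr_gap_def)
  finally have "\<forall>\<^sub>F N in sequentially.
      0 < phi 1 x * log_kernel x / (2 * x) - ln (1 + x) / x + 2 * (\<Sum>k<N. phi (k + 2) r)"
    by (rule order_tendstoD) (use gap in \<open>simp add: x_def\<close>)
  then obtain N where N: "0 < phi 1 x * log_kernel x / (2 * x) - ln (1 + x) / x + 2 * (\<Sum>k<N. phi (k + 2) r)"
    by (auto simp: eventually_sequentially)
  have "(E N \<longlongrightarrow> (1 + 1) / 2 * (phi 1 x * log_kernel x / (2 * x)) - ln (1 + x) / (1 * x)
      + (1 + 1) * (\<Sum>k<N. 1 ^ Suc k * phi (k + 2) r)) (at_left 1)"
    unfolding E_def using x by (intro tendsto_intros) auto
  then have "\<forall>\<^sub>F a in at_left 1. 0 < E N a"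
    by (rule order_tendstoD) (use N in simp)
  moreover have "\<forall>\<^sub>F a in at_left (1::real). a \<in> {0<..<1}"
    by (rule eventually_at_left_real) simp
  ultimately have "\<forall>\<^sub>F a in at_left (1::real). 0 < E N a \<and> a \<in> {0<..<1}"
    by (rule eventually_conj)
  then obtain a where E: "0 < E N a" and a: "0 < a" "a < 1"
    by (auto dest!: eventually_happens)
  have coeff: "norm (taylor_coeff (disc_auto a) (k + 2)) = (1 - a\<^sup>2) * a ^ Suc k" for k
    using norm_taylor_coeff_disc_auto[of a "Suc k"] a by simp
  have "(\<Sum>k<N. norm (taylor_coeff (disc_auto a) (k + 2)) * phi (k + 2) r)
      \<le> (\<Sum>k. norm (taylor_coeff (disc_auto a) (k + 2)) * phi (k + 2) r)"
  proof (rule sum_le_suminf)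
    have "1 - a\<^sup>2 \<ge> 0" using a by (simp add: power_le_one)
    then have "norm (norm (taylor_coeff (disc_auto a) (k + 2)) * phi (k + 2) r) \<le> 1 * phi (k + 2) r" for k
      unfolding coeff norm_mult using a r
      by (intro mult_mono) (auto simp: phi_nonneg power_le_one abs_mult intro!: mult_le_one)
    then show "summable (\<lambda>k. norm (taylor_coeff (disc_auto a) (k + 2)) * phi (k + 2) r)"
      by (intro summable_comparison_test'[OF sums_summable[OF phi_tail_sums[OF r]], of 0]) simp
  qed (use r in \<open>auto intro!: mult_nonneg_nonneg phi_nonneg\<close>)
  moreover have "(\<Sum>k<N. norm (taylor_coeff (disc_auto a) (k + 2)) * phi (k + 2) r)
      = (1 - a) * ((1 + a) * (\<Sum>k<N. a ^ Suc k * phi (k + 2) r))"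
    unfolding coeff by (simp add: sum_distrib_left algebra_simps power2_eq_square)
  moreover have "0 < (1 - a) * E N a" using a E by simp
  then have "- ln (1 - x) / x < - ln (1 - x) / x
      + (1 - a) * ((1 + a) / 2 * (phi 1 x * log_kernel x / (2 * x)) - ln (1 + x) / (a * x))
      + (1 - a) * ((1 + a) * (\<Sum>k<N. a ^ Suc k * phi (k + 2) r))"
    unfolding E_def by (simp add: algebra_simps)
  moreover note cesaro_disc_auto_lower[OF a x]
  moreover have "log_quot x = - ln (1 - x) / x" using x by (simp add: log_quot_def ln_div)
  ultimately have "log_quot x < norm (cesaro (disc_auto a) (of_real x))
      + norm (cesaro (deriv (disc_auto a)) (of_real x)) * phi 1 x
      + (\<Sum>k. norm (taylor_coeff (disc_auto a) (k + 2)) * phi (k + 2) r)"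
    by linarith
  then have "\<not> cesaro_bohr_ineq m (disc_auto a) (\<lambda>z. z ^ m) (of_real r)"
    using r by (simp add: cesaro_bohr_ineq_def x_def)
  with a that show ?thesis by blast
qed

section \<open>The two radii, the inequality up to the smaller one, and its optimality\<close>

theorem theorem2p2:
  fixes m :: nat
  assumes "m \<ge> 1"
  shows "\<exists>Rm Rm1 :: real.
    (\<forall>r. (r \<in> {0<..<1} \<and>
          2 * (- (r ^ m) - ln (1 - r ^ m)) = r ^ m * (1 - r ^ (2 * m)))
         \<longleftrightarrow> r = Rm) \<and>
    (\<forall>r. (r \<in> {0<..<1} \<and>
          (- (r ^ m) - ln (1 - r ^ m)) / (2 * r ^ m)
            * (- (1 / r ^ m * ln (1 - r ^ m)) + 1 / r ^ m * ln (1 + r ^ m) + 2 / (1 + r ^ m))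
          + 2 * (r ^ 2 / (1 - r) + r + 2 + 2 / r * ln (1 - r))
          - 1 / r ^ m * ln (1 + r ^ m) = 0)
         \<longleftrightarrow> r = Rm1) \<and>
    Rm1 \<le> Rm \<and>
    (\<forall>f \<in> schur_class. \<forall>\<omega> \<in> schur_class_ord m. \<forall>z. norm z \<le> Rm1 \<longrightarrow> cesaro_bohr_ineq m f \<omega> z) \<and>
    (\<forall>\<rho> \<in> {Rm1<..<1}.
       \<not> (\<forall>f \<in> schur_class. \<forall>\<omega> \<in> schur_class_ord m. \<forall>z. norm z \<le> \<rho> \<longrightarrow> cesaro_bohr_ineq m f \<omega> z))"
proof -
  have pow: "0 < r ^ m" "r ^ m < 1" "r ^ m \<le> r" if "0 < r" "r < 1" for r :: real
    using that assms power_decreasing[of 1 m r] by (auto simp: power_less_one_iff)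
  obtain x0 where x0: "12 / 25 < x0" "x0 < 1" "phi 1 x0 = (1 - x0\<^sup>2) / 2"
    using ex_critical_point by blast
  \<comment> \<open>The first equation involves \<open>r\<close> only through \<open>r ^ m\<close>,
    so one critical point serves all \<open>m\<close>.\<close>
  define Rm where "Rm = root m x0"
  have Rm: "0 < Rm" "Rm < 1" "Rm ^ m = x0"
    using assms x0 by (auto simp: Rm_def)
  have gap_mono: "bohr_gap (r ^ m) r < bohr_gap (s ^ m) s" if "0 < r" "r < s" "s < 1" for r s
    using that pow[of r] pow[of s] by (intro bohr_gap_strict_mono power_mono) auto
  have lam_mono: "phi 1 (r ^ m) + (r ^ m)\<^sup>2 / 2 < phi 1 (s ^ m) + (s ^ m)\<^sup>2 / 2"
    if "0 < r" "r < s" "s < 1" for r s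
  proof -
    have "r ^ m < s ^ m" using that assms by (intro power_strict_mono) auto
    then show ?thesis
      using that assms pow[of r] pow[of s]
      by (intro add_strict_mono phi_1_strict_mono divide_strict_right_mono power_strict_mono) auto
  qed
  \<comment> \<open>Applying the intermediate value theorem only up to \<open>Rm\<close> yields
    \<open>Rm1 <= Rm\<close> along with existence.\<close>
  have "\<exists>r\<ge>1/10. r \<le> Rm \<and> bohr_gap (r ^ m) r = 0"
  proof (rule IVT')
    show "bohr_gap ((1 / 10) ^ m) (1 / 10) \<le> 0"
      using bohr_gap_neg[of "(1 / 10) ^ m"] pow[of "1 / 10"] by simp
    show "0 \<le> bohr_gap (Rm ^ m) Rm"
      using bohr_gap_nonneg_at_critical_point[OF x0, of Rm] Rm pow(3)[of Rm] by simp
    show "1 / 10 \<le> Rm" using pow(3)[of Rm] Rm x0 by simp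
    show "continuous_on {1 / 10..Rm} (\<lambda>r. bohr_gap (r ^ m) r)"
      by (rule continuous_on_subset[OF continuous_on_bohr_gap[OF assms]]) (use Rm in auto)
  qed
  then obtain Rm1 where Rm1: "1 / 10 \<le> Rm1" "Rm1 \<le> Rm" "bohr_gap (Rm1 ^ m) Rm1 = 0"
    by blast
  have Rm_eq: "r \<in> {0<..<1} \<and> 2 * (- (r ^ m) - ln (1 - r ^ m)) = r ^ m * (1 - r ^ (2 * m))
      \<longleftrightarrow> r = Rm" for r
  proof -
    have "2 * (- (r ^ m) - ln (1 - r ^ m)) = r ^ m * (1 - r ^ (2 * m))
        \<longleftrightarrow> phi 1 (r ^ m) + (r ^ m)\<^sup>2 / 2 = 1 / 2" if "0 < r" "r < 1"
      unfolding power_even_eq by (rule critical_point_iff[OF pow(1,2)[OF that]])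
    moreover have "phi 1 (Rm ^ m) + (Rm ^ m)\<^sup>2 / 2 = 1 / 2"
      unfolding Rm(3) x0(3) by (simp add: field_simps)
    moreover have "phi 1 (r ^ m) + (r ^ m)\<^sup>2 / 2 \<noteq> phi 1 (Rm ^ m) + (Rm ^ m)\<^sup>2 / 2"
      if "0 < r" "r < 1" "r \<noteq> Rm"
      using lam_mono[of r Rm] lam_mono[of Rm r] that Rm(1,2) by linarith
    ultimately show ?thesis
      using Rm(1,2) by (metis greaterThanLessThan_iff)
  qed
  have Rm1_eq: "r \<in> {0<..<1} \<and>
          (- (r ^ m) - ln (1 - r ^ m)) / (2 * r ^ m)
            * (- (1 / r ^ m * ln (1 - r ^ m)) + 1 / r ^ m * ln (1 + r ^ m) + 2 / (1 + r ^ m))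
          + 2 * (r ^ 2 / (1 - r) + r + 2 + 2 / r * ln (1 - r))
          - 1 / r ^ m * ln (1 + r ^ m) = 0 \<longleftrightarrow> r = Rm1" for r
  proof -
    have "bohr_gap (r ^ m) r \<noteq> 0" if "0 < r" "r < 1" "r \<noteq> Rm1"
      using gap_mono[of r Rm1] gap_mono[of Rm1 r] that Rm1 Rm(1,2) by linarith
    moreover have "0 < Rm1" "Rm1 < 1" using Rm1(1,2) Rm(2) by linarith+
    moreover note bohr_gap_eq[OF pow(1,2), of r r] Rm1(3)
    ultimately show ?thesis by (metis greaterThanLessThan_iff)
  qed
  have ineq: "cesaro_bohr_ineq m f \<omega> z"
    if f: "f \<in> schur_class" and \<omega>: "\<omega> \<in> schur_class_ord m" and z: "norm z \<le> Rm1" for f \<omega> z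
  proof (cases "z = 0")
    case True
    then show ?thesis using cesaro_bohr_ineq_0[OF f \<omega> assms] by simp
  next
    case False
    \<comment> \<open>\<open>norm z <= Rm\<close> supplies the condition on \<open>phi 1\<close>,
      and \<open>norm z <= Rm1\<close> the sign of the gap.\<close>
    then have r: "0 < norm z" "norm z \<le> Rm" "norm z < 1" using z Rm1 Rm by auto
    have "phi 1 (norm z ^ m) + (norm z ^ m)\<^sup>2 / 2 \<le> phi 1 (Rm ^ m) + (Rm ^ m)\<^sup>2 / 2"
      using lam_mono[of "norm z" Rm] r Rm by (cases "norm z = Rm") auto
    then have "phi 1 (norm z ^ m) \<le> (1 - (norm z ^ m)\<^sup>2) / 2" using Rm x0 by simp
    moreover have "bohr_gap (norm z ^ m) (norm z) \<le> 0"
      using gap_mono[of "norm z" Rm1] r z Rm1 Rm by (cases "norm z = Rm1") auto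
    ultimately show ?thesis
      by (intro cesaro_bohr_ineq_if_bohr_gap_nonpos f \<omega> assms False r)
  qed
  have sharp: "\<not> (\<forall>f \<in> schur_class. \<forall>\<omega> \<in> schur_class_ord m. \<forall>z. norm z \<le> \<rho> \<longrightarrow> cesaro_bohr_ineq m f \<omega> z)"
    if \<rho>: "\<rho> \<in> {Rm1<..<1}" for \<rho>
  proof -
    \<comment> \<open>The inequality already fails at the point \<open>z = \<rho>\<close>, where the
      gap is positive.\<close>
    have "0 < \<rho>" "\<rho> < 1" using \<rho> Rm1 by auto
    moreover have "0 < bohr_gap (\<rho> ^ m) \<rho>" using gap_mono[of Rm1 \<rho>] \<rho> Rm1 by auto
    ultimately obtain a where "0 < a" "a < 1"
      "\<not> cesaro_bohr_ineq m (disc_auto a) (\<lambda>z. z ^ m) (of_real \<rho>)"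
      using not_cesaro_bohr_ineq_if_bohr_gap_pos[OF assms] by metis
    with \<open>0 < \<rho>\<close> show ?thesis
      using disc_auto_in_schur_class[of a] monomial_in_schur_class_ord[of m]
      by (intro notI) (metis less_imp_le norm_of_real abs_of_pos order.refl)
  qed
  show ?thesis using Rm_eq Rm1_eq Rm1(2) ineq sharp by blast
qed

end
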